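(* Let $k\ge2$ and $n\ge2$ be integers, let $\mathbf{m}=(k,\dots,k,1)\in\mathbb{Z}^n$, let $d=k(n-2)+1$ be the degree of $A_{\mathbf{m}}^{\mathbf{1}}$, and let $(a,b)$ be the $\mathcal{I}_d$-decomposition of $A_{\mathbf{m}}^{\mathbf{1}}$. Then $$a=\sum_{i=0}^{\lfloor (k(n-2)+1)/2\rfloor}\gamma_{n,i}\,x^i(1+x)^{k(n-2)+1-2i},$$ where $\gamma_{n,i}$ is the number of weakly increasing trees on the multiset $\{1^k,2^k,\dots,(n-2)^k,n-1,n\}$ with $i+1$ leaves and no young leaves.
   Context: For $\mathbf{m}=(m_1,\dots,m_n)$ a vector of positive integers with $m=m_1+\cdots+m_n$, the multiset Eulerian polynomial is $A_{\mathbf{m}}^{\mathbf{1}}=\sum_{\pi}x^{\mathrm{des}(\pi)}$, the sum over all words $\pi=\pi_1\cdots\pi_m$ in which each $j\in\{1,\dots,n\}$ appears exactly $m_j$ times, where $\mathrm{des}(\pi)=|\{j\in\{1,\dots,m-1\}:\pi_j>\pi_{j+1}\}|$. A polynomial $p$ of degree at most $N$ is symmetric with respect to $N$ if $p_s=p_{N-s}$ for $0\le s\le N$. The $\mathcal{I}_N$-decomposition of a polynomial $p$ of degree at most $N$ is the unique pair $(a,b)$ of real polynomials with $p=a+xb$, $\deg a\le N$, $\deg b\le N-1$, $a$ symmetric with respect to $N$ and $b$ symmetric with respect to $N-1$. In a multiset, $j^k$ denotes $k$ copies of $j$. A plane tree is a rooted tree in which the children of each node are (linearly) ordered. A weakly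 increasing tree on a multiset $M$ of positive integers is a plane tree such that (i) it has $|M|+1$ nodes, labeled by the elements of $M\cup\{0\}$ (as a multiset); (ii) the root is labeled $0$ and each node has a label weakly greater than that of its parent; (iii) the labels of the children of each node are weakly increasing from left to right. (Copies of the same label are indistinguishable.) A leaf is a non-root node with no children. A leaf is old if it is the rightmost child of its parent, and young otherwise. *)

theory Defs
  imports
    "HOL-Computational_Algebra.Polynomial"
    "HOL-Combinatorics.Multiset_Permutations"
begin

section \<open>Multiset Eulerian polynomials\<close>

(* For ms = [m_1, ..., m_n]: the letters are 1, ..., n, hence the shift between
   letters and list positions. *)
definition vec_mset :: "nat list \<Rightarrow> nat multiset" where
  "vec_mset ms = (\<Sum>j=1..length ms. replicate_mset (ms ! (j - 1)) j)"

definition des :: "nat list \<Rightarrow> nat" where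
  "des w = card {j. Suc j < length w \<and> w ! j > w ! Suc j}"

definition multiset_eulerian :: "nat list \<Rightarrow> real poly" where
  "multiset_eulerian ms = (\<Sum>w\<in>permutations_of_multiset (vec_mset ms). monom 1 (des w))"


section \<open>Symmetric decomposition\<close>

definition symmetric_poly :: "nat \<Rightarrow> real poly \<Rightarrow> bool" where
  "symmetric_poly N p \<longleftrightarrow> degree p \<le> N \<and> (\<forall>s\<le>N. coeff p s = coeff p (N - s))"

(* The degree of b is at most N - 1 as an integer: for N = 0 this forces b = 0, which the
   truncated subtraction N - 1 would not express. *)
definition I_decomposition :: "nat \<Rightarrow> real poly \<Rightarrow> real poly \<Rightarrow> real poly \<Rightarrow> bool" where
  "I_decomposition N p a b \<longleftrightarrow>
     p = a + [:0, 1:] * b \<and> symmetric_poly N a \<and>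
     (b = 0 \<or> degree b < N) \<and> symmetric_poly (N - 1) b"

lemma coeff_X_mult: "coeff ([:0, 1:] * b) s = (case s of 0 \<Rightarrow> 0 | Suc t \<Rightarrow> coeff b t)"
  for b :: "real poly"
  by (simp add: coeff_pCons split: nat.split)

lemma I_decomposition_unique:
  assumes "I_decomposition N p a b" "I_decomposition N p a' b'"
  shows "a = a' \<and> b = b'"
proof -
  define u where "u = a - a'"
  define v where "v = b - b'"
  have dv: "coeff v s = 0" if "N \<le> s" for s
  proof -
    have "coeff b s = 0" "coeff b' s = 0"
      using assms that by (auto simp: I_decomposition_def intro: coeff_eq_0)
    thus ?thesis by (simp add: v_def)
  qed
  have du: "coeff u s = 0" if "N < s" for s
    using assms that
    by (auto simp: I_decomposition_def symmetric_poly_def u_def coeff_eq_0)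
  have su: "coeff u s = coeff u (N - s)" if "s \<le> N" for s
    using assms that unfolding I_decomposition_def symmetric_poly_def u_def coeff_diff by metis
  have sv: "coeff v s = coeff v (N - 1 - s)" if "s \<le> N - 1" for s
    using assms that unfolding I_decomposition_def symmetric_poly_def v_def coeff_diff by metis
  have "u + [:0, 1:] * v = 0"
    using assms unfolding I_decomposition_def u_def v_def right_diff_distrib
    by (metis (no_types, lifting) add_diff_add diff_self)
  hence "coeff u s + coeff ([:0, 1:] * v) s = 0" for s
    by (metis coeff_0 coeff_add)
  hence e: "coeff u 0 = 0" "coeff u (Suc s) = - coeff v s" for s
    by (simp_all only: coeff_X_mult nat.case add_0_right add_eq_0_iff2)
  have main: "coeff u s = 0" if "s \<le> N" for s
    using that
  proof (induction s)
    case (Suc s)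
    have "coeff u (N - s) = 0" using Suc su[of s] by simp
    moreover have "N - s = Suc (N - 1 - s)" using Suc.prems by simp
    ultimately have "coeff v (N - 1 - s) = 0" using e(2) by simp
    hence "coeff v s = 0" using sv[of s] Suc.prems by simp
    thus ?case using e(2) by simp
  qed (use e in simp)
  have "u = 0" by (rule poly_eqI) (use main du in \<open>auto simp: not_le[symmetric]\<close>)
  moreover have "v = 0" using e(2) \<open>u = 0\<close> by (intro poly_eqI) (metis coeff_0 neg_equal_0_iff_equal)
  ultimately show ?thesis by (simp add: u_def v_def)
qed

lemma I_decomposition_exists:
  assumes "degree p \<le> N"
  shows "\<exists>a b. I_decomposition N p a b"
proof -
  define q where "q i = coeff p (N - i) - coeff p i" for i
  define B where "B s = (\<Sum>i<s. q i)" for s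
  have qN: "q (N - i) = - q i" if "i \<le> N" for i using that by (simp add: q_def)
  have "(\<Sum>i\<le>N. q i) = (\<Sum>i\<le>N. q (N - i))"
    by (rule sum.reindex_bij_witness[of _ "\<lambda>i. N - i" "\<lambda>i. N - i"]) auto
  also have "\<dots> = - (\<Sum>i\<le>N. q i)" by (simp add: qN sum_negf)
  finally have tot: "B (Suc N) = 0" by (simp add: B_def lessThan_Suc_atMost)
  have Bs: "B (Suc N - s) = B s" if "s \<le> Suc N" for s
    using that
  proof (induction s)
    case 0 show ?case using tot by (simp add: B_def)
  next
    case (Suc s)
    have "Suc N - s = Suc (N - s)" using Suc by simp
    hence "B (Suc N - s) = B (N - s) + q (N - s)" by (simp add: B_def)
    thus ?case using Suc qN[of s] by (simp add: B_def)
  qed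
  define b where "b = (\<Sum>s<N. monom (B (Suc s)) s)"
  define a where "a = p - [:0, 1:] * b"
  have cb: "coeff b s = (if s < N then B (Suc s) else 0)" for s
    by (simp add: b_def coeff_sum)
  have ca: "coeff a s = coeff p s - (if s \<le> N then B s else 0)" for s
    unfolding a_def coeff_diff coeff_X_mult by (cases s) (auto simp: cb B_def)
  have db: "b = 0 \<or> degree b < N"
    by (metis cb leading_coeff_0_iff)
  have "symmetric_poly N a"
    unfolding symmetric_poly_def
  proof (intro conjI allI impI)
    show "degree a \<le> N" using assms by (intro degree_le) (auto simp: ca coeff_eq_0)
    fix s assume s: "s \<le> N"
    have "B (N - s) = B (Suc s)" using Bs[of "Suc s"] s by simp
    thus "coeff a s = coeff a (N - s)" using s by (simp add: ca B_def q_def)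
  qed
  moreover have "symmetric_poly (N - 1) b"
    unfolding symmetric_poly_def
  proof (intro conjI allI impI)
    show "degree b \<le> N - 1" using db by auto
    fix s assume s: "s \<le> N - 1"
    show "coeff b s = coeff b (N - 1 - s)"
    proof (cases "N = 0")
      case False
      hence "B (N - s) = B (Suc s)" "Suc (N - 1 - s) = N - s" using Bs[of "Suc s"] s by auto
      thus ?thesis using s False by (simp add: cb)
    qed (simp add: cb)
  qed
  ultimately show ?thesis using db
    unfolding I_decomposition_def by (intro exI[of _ a] exI[of _ b]) (simp add: a_def)
qed


section \<open>Weakly increasing trees\<close>

datatype ptree = Node (label: nat) (children: "ptree list")

fun labels :: "ptree \<Rightarrow> nat multiset" where
  "labels (Node l ts) = add_mset l (\<Sum>t\<leftarrow>ts. labels t)"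

fun increasing :: "ptree \<Rightarrow> bool" where
  "increasing (Node l ts) \<longleftrightarrow>
     sorted (map label ts) \<and> (\<forall>t\<in>set ts. l \<le> label t \<and> increasing t)"

(* labels t has one element per node, so the first condition also fixes the number of nodes. *)
definition weakly_increasing_trees :: "nat multiset \<Rightarrow> ptree set" where
  "weakly_increasing_trees M = {t. labels t = add_mset 0 M \<and> label t = 0 \<and> increasing t}"

(* Leaves are counted at their parents, so the root is never a leaf and a leaf is young
   exactly if it occurs in butlast of its list of siblings. *)
fun leaves :: "ptree \<Rightarrow> nat" where
  "leaves (Node l ts) = length (filter (\<lambda>t. children t = []) ts) + (\<Sum>t\<leftarrow>ts. leaves t)"

fun young_leaves :: "ptree \<Rightarrow> nat" where
  "young_leaves (Node l ts) =
     length (filter (\<lambda>t. children t = []) (butlast ts)) + (\<Sum>t\<leftarrow>ts. young_leaves t)"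

definition tree_gamma :: "nat multiset \<Rightarrow> nat \<Rightarrow> nat" where
  "tree_gamma M i =
     card {t \<in> weakly_increasing_trees M. leaves t = i + 1 \<and> young_leaves t = 0}"

lemma size_labels_ge: "t \<in> set ts \<Longrightarrow> size (labels t) < size (labels (Node l ts))"
  by (induction ts) auto

lemma length_le_size_labels: "length ts < size (labels (Node l ts))"
proof (induction ts)
  case (Cons t ts)
  have "0 < size (labels t)" by (cases t) simp
  thus ?case using Cons by simp
qed simp

lemma set_labels_subset: "t \<in> set ts \<Longrightarrow> set_mset (labels t) \<subseteq> set_mset (labels (Node l ts))"
  by (induction ts) auto

lemma finite_trees:
  assumes "finite L"
  shows "finite {t. set_mset (labels t) \<subseteq> L \<and> size (labels t) \<le> n}"
proof (induction n)
  case 0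
  have "{t. set_mset (labels t) \<subseteq> L \<and> size (labels t) \<le> 0} = {}"
    by (auto elim: labels.elims)
  thus ?case by (simp only: finite.emptyI)
next
  case (Suc n)
  let ?T = "{t. set_mset (labels t) \<subseteq> L \<and> size (labels t) \<le> n}"
  have "{t. set_mset (labels t) \<subseteq> L \<and> size (labels t) \<le> Suc n}
        \<subseteq> case_prod Node ` (L \<times> {ts. set ts \<subseteq> ?T \<and> length ts \<le> n})"
  proof
    fix t assume t: "t \<in> {t. set_mset (labels t) \<subseteq> L \<and> size (labels t) \<le> Suc n}"
    obtain l ts where eq: "t = Node l ts" by (cases t)
    have "l \<in> L" using t eq by auto
    moreover have "set ts \<subseteq> ?T"
      using t size_labels_ge[of _ ts l] set_labels_subset[of _ ts l] unfolding eq by fastforce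
    moreover have "length ts \<le> n" using t length_le_size_labels[of ts l] unfolding eq by simp
    ultimately show "t \<in> case_prod Node ` (L \<times> {ts. set ts \<subseteq> ?T \<and> length ts \<le> n})"
      using eq by auto
  qed
  thus ?case
    by (rule finite_subset) (intro finite_imageI finite_cartesian_product assms
        finite_lists_length_le Suc.IH)
qed

lemma finite_weakly_increasing_trees: "finite (weakly_increasing_trees M)"
  by (rule finite_subset[OF _ finite_trees[of "set_mset (add_mset 0 M)" "size (add_mset 0 M)"]])
     (auto simp: weakly_increasing_trees_def)

end

(*
  Attach weights y to young leaves, q to pairs (parent, old leaf) and r to all remaining nodes.
  Inserting p copies of a new largest label into a weakly increasing tree means hanging a plane
  forest below every node; marking the new nodes by z, this is the substitution
    y -> y + G,  r -> r + G,  q -> q + (y + r) G + G^2,   G = z (q + (y + r) G + G^2).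
  With y = s - c, r = 1 + c + s and q = s + s^2 the substitution is just s -> H = s + G, where
  H = s + z (H + H^2), so Lagrange inversion turns the insertion of p labels into the operator
  (1/p!) D^p phi^p, phi = s + s^2, acting on the derivative with respect to s.  This does not
  depend on c, and c = s removes all trees with young leaves.

  On the other side, if b_l counts the words on {1^k,...,j^k} with l descents and N = k (j - 1),
  then inserting k copies of a new largest letter acts on sum_l b_l s^l (1 + s)^(N - l) by the same
  operator (1/k!) D^k phi^k.  The b_l are symmetric, and inserting one more largest letter gives
  A = a + x b with b = (k - 1) sum_l b_l x^l and a_l = (l + 1) b_l + (N + 2 - l) b_(l-1); comparing
  with phi D phi, which inserts two single labels into the trees, identifies a at x = s / (1 + s).
*)

theory Submission
  imports Defs "HOL-Computational_Algebra.Formal_Power_Series"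
begin

section \<open>Generating functions of sets with a counting statistic\<close>

definition graded :: "('a \<Rightarrow> nat) \<Rightarrow> 'a set \<Rightarrow> bool" where
  "graded c S \<longleftrightarrow> (\<forall>p. finite {a\<in>S. c a = p})"

text \<open>A coefficient with an infinite fibre would silently be 0, the value of
  \<open>sum\<close> over an infinite set; \<open>graded\<close> excludes this wherever fibres are
  united or multiplied.\<close>

definition gf :: "('a \<Rightarrow> nat) \<Rightarrow> ('a \<Rightarrow> 'r::comm_ring_1) \<Rightarrow> 'a set \<Rightarrow> 'r fps" where
  "gf c f S = Abs_fps (\<lambda>p. \<Sum>a\<in>{a\<in>S. c a = p}. f a)"

lemma graded_subset: "graded c T \<Longrightarrow> S \<subseteq> T \<Longrightarrow> graded c S"
  unfolding graded_def
proof (rule allI)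
  fix p
  assume *: "\<forall>p. finite {a\<in>T. c a = p}" "S \<subseteq> T"
  have "{a\<in>S. c a = p} \<subseteq> {a\<in>T. c a = p}" using *(2) by auto
  thus "finite {a\<in>S. c a = p}" using *(1) finite_subset by metis
qed

lemma graded_image:
  assumes "graded c S" "\<And>a. a \<in> S \<Longrightarrow> c' (h a) = c a + s"
  shows "graded c' (h ` S)"
  unfolding graded_def
proof (rule allI)
  fix p
  have "{u\<in>h ` S. c' u = p} \<subseteq> h ` {a\<in>S. c a = p - s}" using assms(2) by auto
  moreover have "finite (h ` {a\<in>S. c a = p - s})" using assms(1) by (simp add: graded_def)
  ultimately show "finite {u\<in>h ` S. c' u = p}" by (rule finite_subset)
qed

lemma gf_nth: "fps_nth (gf c f S) p = (\<Sum>a\<in>{a\<in>S. c a = p}. f a)"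
  by (simp add: gf_def)

lemma gf_cong: "(\<And>a. a \<in> S \<Longrightarrow> f a = g a) \<Longrightarrow> gf c f S = gf c g S"
  by (rule fps_ext) (auto simp: gf_nth intro: sum.cong)

lemma gf_cmult: "gf c (\<lambda>a. k * f a) S = fps_const k * gf c f S"
  by (rule fps_ext) (simp add: gf_nth sum_distrib_left)

lemma gf_singleton: "gf c f {a} = fps_const (f a) * fps_X ^ c a"
proof (rule fps_ext)
  fix p
  have "{b \<in> {a}. c b = p} = (if p = c a then {a} else {})" by auto
  thus "fps_nth (gf c f {a}) p = fps_nth (fps_const (f a) * fps_X ^ c a) p"
    unfolding gf_nth \<open>{b \<in> {a}. c b = p} = _\<close> by (cases "p = c a") (simp_all add: fps_X_power_nth)
qed

lemma gf_union:
  assumes "graded c S" "graded c T" "S \<inter> T = {}"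
  shows "gf c f (S \<union> T) = gf c f S + gf c f T"
proof (rule fps_ext)
  fix p
  have "{a \<in> S \<union> T. c a = p} = {a\<in>S. c a = p} \<union> {a\<in>T. c a = p}" by auto
  thus "fps_nth (gf c f (S \<union> T)) p = fps_nth (gf c f S + gf c f T) p"
    using assms by (auto simp: gf_nth graded_def intro!: sum.union_disjoint)
qed

text \<open>The shift \<open>s\<close> is the number of largest labels or letters that
  \<open>h\<close> itself adds: 1 for a new root or first letter \<open>n\<close>, 0 for an old
  one.\<close>

lemma gf_bij:
  assumes h: "bij_betw h S U"
    and c: "\<And>a. a \<in> S \<Longrightarrow> c' (h a) = c a + s"
    and e: "\<And>a. a \<in> S \<Longrightarrow> e (h a) = f a"
  shows "gf c' e U = fps_X ^ s * gf c f S"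
proof (rule fps_ext)
  fix p
  have "bij_betw h {a\<in>S. c a + s = p} {u\<in>U. c' u = p}"
    using h c unfolding bij_betw_def by (auto intro: inj_on_subset)
  hence "(\<Sum>u\<in>{u\<in>U. c' u = p}. e u) = (\<Sum>a\<in>{a\<in>S. c a + s = p}. e (h a))"
    by (rule sum.reindex_bij_betw[symmetric])
  also have "\<dots> = (\<Sum>a\<in>{a\<in>S. c a + s = p}. f a)"
    by (rule sum.cong) (auto simp: e)
  also have "\<dots> = fps_nth (fps_X ^ s * gf c f S) p"
  proof (cases "p < s")
    case False
    hence "{a\<in>S. c a + s = p} = {a\<in>S. c a = p - s}" by auto
    with False show ?thesis by (simp add: gf_nth fps_X_power_mult_nth)
  qed (auto simp: fps_X_power_mult_nth intro!: sum.neutral)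
  finally show "fps_nth (gf c' e U) p = fps_nth (fps_X ^ s * gf c f S) p"
    by (simp add: gf_nth)
qed

text \<open>Splitting each fibre of \<open>c''\<close> by the value \<open>i\<close> of
  \<open>c\<close> on the first component gives the Cauchy product.\<close>

lemma gf_prod:
  assumes h: "bij_betw (\<lambda>(a, b). h a b) (S \<times> T) U"
    and S: "graded c S" and T: "graded c' T"
    and c: "\<And>a b. a \<in> S \<Longrightarrow> b \<in> T \<Longrightarrow> c'' (h a b) = c a + c' b"
    and e: "\<And>a b. a \<in> S \<Longrightarrow> b \<in> T \<Longrightarrow> e (h a b) = f a * g b"
  shows "gf c'' e U = gf c f S * gf c' g T"
proof (rule fps_ext)
  fix p
  define P where "P = (\<lambda>i. {a\<in>S. c a = i} \<times> {b\<in>T. c' b = p - i})"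
  have "bij_betw (\<lambda>(a, b). h a b) (\<Union>i\<in>{0..p}. P i) {u\<in>U. c'' u = p}"
    unfolding bij_betw_def
  proof
    show "inj_on (\<lambda>(a, b). h a b) (\<Union>i\<in>{0..p}. P i)"
      using h unfolding bij_betw_def by (auto simp: P_def intro: inj_on_subset)
    show "(\<lambda>(a, b). h a b) ` (\<Union>i\<in>{0..p}. P i) = {u\<in>U. c'' u = p}"
    proof (intro equalityI subsetI)
      fix u assume "u \<in> (\<lambda>(a, b). h a b) ` (\<Union>i\<in>{0..p}. P i)"
      thus "u \<in> {u\<in>U. c'' u = p}" using bij_betwE[OF h] by (auto simp: P_def c)
    next
      fix u assume u: "u \<in> {u\<in>U. c'' u = p}"
      then obtain a b where ab: "a \<in> S" "b \<in> T" "u = h a b"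
        using bij_betw_imp_surj_on[OF h] by (auto simp: image_iff)
      hence "(a, b) \<in> P (c a)" "c a \<le> p" using u c by (auto simp: P_def)
      thus "u \<in> (\<lambda>(a, b). h a b) ` (\<Union>i\<in>{0..p}. P i)"
        using ab by (intro image_eqI[of _ _ "(a, b)"]) auto
    qed
  qed
  hence "(\<Sum>u\<in>{u\<in>U. c'' u = p}. e u) = (\<Sum>x\<in>(\<Union>i\<in>{0..p}. P i). e (case x of (a, b) \<Rightarrow> h a b))"
    by (rule sum.reindex_bij_betw[symmetric])
  also have "\<dots> = (\<Sum>x\<in>(\<Union>i\<in>{0..p}. P i). f (fst x) * g (snd x))"
    by (rule sum.cong) (auto simp: P_def e)
  also have "\<dots> = (\<Sum>i\<in>{0..p}. \<Sum>x\<in>P i. f (fst x) * g (snd x))"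
    using S T by (intro sum.UNION_disjoint) (auto simp: P_def graded_def)
  also have "\<dots> = (\<Sum>i=0..p. fps_nth (gf c f S) i * fps_nth (gf c' g T) (p - i))"
    by (rule sum.cong) (auto simp: P_def gf_nth sum_product sum.cartesian_product split_beta)
  finally show "fps_nth (gf c'' e U) p = fps_nth (gf c f S * gf c' g T) p"
    by (simp add: gf_nth fps_mult_nth)
qed

section \<open>Inserting copies of the largest label into a weakly increasing tree\<close>

definition forest_labels :: "ptree list \<Rightarrow> nat multiset" where
  "forest_labels ts = (\<Sum>t\<leftarrow>ts. labels t)"

lemma forest_labels_simps [simp]: "forest_labels [] = {#}" "forest_labels (t # ts) = labels t + forest_labels ts"
  by (simp_all add: forest_labels_def)

lemma labels_Node [simp]: "labels (Node l ts) = add_mset l (forest_labels ts)"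
  by (simp add: forest_labels_def)

declare labels.simps [simp del]

lemma set_forest_labels: "set_mset (forest_labels ts) = (\<Union>t\<in>set ts. set_mset (labels t))"
  by (induction ts) auto

definition valid :: "nat \<Rightarrow> ptree \<Rightarrow> bool" where
  "valid n t \<longleftrightarrow> increasing t \<and> set_mset (labels t) \<subseteq> {..n}"

definition forest :: "nat \<Rightarrow> ptree list \<Rightarrow> bool" where
  "forest n us \<longleftrightarrow> sorted (map label us) \<and> (\<forall>t\<in>set us. valid n t)"

lemma valid_Node [simp]:
  "valid n (Node l us) \<longleftrightarrow> l \<le> n \<and> forest n us \<and> (\<forall>t\<in>set us. l \<le> label t)"
  by (auto simp: valid_def forest_def set_forest_labels)

lemma forest_Nil [simp]: "forest n []" 
  by (simp add: forest_def)

lemma forest_Cons [simp]: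
  "forest n (t # us) \<longleftrightarrow> valid n t \<and> forest n us \<and> (\<forall>t'\<in>set us. label t \<le> label t')"
  by (auto simp: forest_def)

lemma valid_label_le: "valid n t \<Longrightarrow> label t \<le> n"
  by (cases t) simp

text \<open>Below a node labelled \<open>n\<close> every label of a \<open>valid n\<close> tree
  equals \<open>n\<close>, so discarding whole subtrees removes exactly the nodes with the largest
  label.\<close>

fun strip :: "nat \<Rightarrow> ptree \<Rightarrow> ptree" where
  "strip n (Node l us) = Node l (map (strip n) (filter (\<lambda>t. label t < n) us))"

abbreviation strip_forest :: "nat \<Rightarrow> ptree list \<Rightarrow> ptree list" where
  "strip_forest n us \<equiv> map (strip n) (filter (\<lambda>t. label t < n) us)"

lemma label_strip [simp]: "label (strip n t) = label t"
  by (cases t) simp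

text \<open>The forests, and the trees whose root is not labelled \<open>n\<close>, that can be obtained by
  inserting nodes with the largest label \<open>n\<close>.\<close>

definition forest_fibre :: "nat \<Rightarrow> ptree list \<Rightarrow> ptree list set" where
  "forest_fibre n ts = {us. forest n us \<and> strip_forest n us = ts}"

definition tree_fibre :: "nat \<Rightarrow> ptree \<Rightarrow> ptree set" where
  "tree_fibre n t = {t'. valid n t' \<and> label t' < n \<and> strip n t' = t}"

abbreviation cnt :: "nat \<Rightarrow> ptree list \<Rightarrow> nat" where
  "cnt n us \<equiv> count (forest_labels us) n"

abbreviation cntT :: "nat \<Rightarrow> ptree \<Rightarrow> nat" where
  "cntT n t \<equiv> count (labels t) n"

text \<open>Labels are squeezed between that of the root and the bound, both equal to
  \<open>n\<close>.\<close>

lemma labels_top: "valid n t \<Longrightarrow> label t = n \<Longrightarrow> x \<in># labels t \<Longrightarrow> x = n"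
proof (induction t)
  case (Node l us)
  show ?case
  proof (cases "x = l")
    case False
    then obtain t where t: "t \<in> set us" "x \<in># labels t" using Node by (auto simp: set_forest_labels)
    hence "valid n t" "label t = n"
      using Node.prems by (auto simp: forest_def intro: antisym valid_label_le)
    thus ?thesis using Node.IH t by blast
  qed (use Node in simp)
qed

lemma labels_strip:
  "valid n t \<Longrightarrow> label t < n \<Longrightarrow> labels (strip n t) = filter_mset (\<lambda>x. x < n) (labels t)"
proof (induction t)
  case (Node l us)
  have "forest n vs \<Longrightarrow> set vs \<subseteq> set us \<Longrightarrow>
    forest_labels (strip_forest n vs) = filter_mset (\<lambda>x. x < n) (forest_labels vs)" for vs
  proof (induction vs)
    case (Cons t vs)
    show ?case
    proof (cases "label t < n")
      case True
      thus ?thesis using Cons Node.IH[of t] by auto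
    next
      case False
      hence "label t = n" using Cons.prems valid_label_le[of n t] by auto
      hence "filter_mset (\<lambda>x. x < n) (labels t) = {#}"
        using labels_top[of n t] Cons.prems by (auto simp: filter_mset_eq_conv)
      thus ?thesis using Cons False by auto
    qed
  qed simp
  thus ?case using Node.prems by auto
qed

lemma forest_labels_strip_forest:
  assumes "0 < n" "forest n us"
  shows "forest_labels (strip_forest n us) = filter_mset (\<lambda>x. x < n) (forest_labels us)"
proof -
  have "labels (strip n (Node 0 us)) = filter_mset (\<lambda>x. x < n) (labels (Node 0 us))"
    using assms by (intro labels_strip) auto
  with assms show ?thesis by simp
qed

lemma forest_labels_le: "forest n us \<Longrightarrow> x \<in># forest_labels us \<Longrightarrow> x \<le> n"
  by (auto simp: forest_def valid_def set_forest_labels)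

lemma forest_labels_forest_fibre:
  assumes "0 < n" "us \<in> forest_fibre n ts"
  shows "forest_labels us = forest_labels ts + replicate_mset (cnt n us) n"
proof (rule multiset_eqI)
  fix x
  have f: "forest n us" "forest_labels ts = filter_mset (\<lambda>x. x < n) (forest_labels us)"
    using assms forest_labels_strip_forest[of n us] by (auto simp: forest_fibre_def)
  have "count (forest_labels us) x = 0" if "x > n"
    using forest_labels_le[OF f(1), of x] that by (metis count_eq_zero_iff leD)
  thus "count (forest_labels us) x = count (forest_labels ts + replicate_mset (cnt n us) n) x"
    by (auto simp: f(2) linorder_neq_iff)
qed

lemma graded_forest_fibre: 
  assumes "0 < n"
  shows "graded (cnt n) (forest_fibre n ts)"
  unfolding graded_def
proof (rule allI)
  fix p
  let ?S = "{us \<in> forest_fibre n ts. cnt n us = p}"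
  let ?T = "{t. set_mset (labels t) \<subseteq> {..n} \<and> size (labels t) \<le> Suc (size (forest_labels ts) + p)}"
  \<comment> \<open>A root 0 turns forests into trees of bounded size with bounded labels, to which
    \<open>finite_trees\<close> applies.\<close>
  have "Node 0 ` ?S \<subseteq> ?T"
  proof (rule image_subsetI)
    fix us assume us: "us \<in> ?S"
    hence "size (forest_labels us) = size (forest_labels ts) + p"
      using forest_labels_forest_fibre[of n us ts] assms by (metis (mono_tags, lifting) mem_Collect_eq size_replicate_mset size_union)
    moreover have "set_mset (forest_labels us) \<subseteq> {..n}"
      using us forest_labels_le[of n us] by (auto simp: forest_fibre_def)
    ultimately show "Node 0 us \<in> ?T" by auto
  qed
  hence "finite (Node 0 ` ?S)" by (rule finite_subset) (rule finite_trees, simp)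
  thus "finite ?S" by (rule finite_imageD) (auto intro: inj_onI)
qed

text \<open>The weight of a root together with its list of subtrees. Here \<open>q\<close> pays for an old leaf
  and its parent at once, so that \<open>r\<close> only occurs for nodes without an old leaf as a child.\<close>

fun forest_weight :: "'r::comm_ring_1 \<Rightarrow> 'r \<Rightarrow> 'r \<Rightarrow> ptree list \<Rightarrow> 'r" where
  "forest_weight y r q [] = r"
| "forest_weight y r q [Node l cs] = (if cs = [] then q else r * forest_weight y r q cs)"
| "forest_weight y r q (Node l cs # t # ts) = (if cs = [] then y else forest_weight y r q cs) * forest_weight y r q (t # ts)"

text \<open>The factor that a tree contributes as a child which is not the rightmost one;
  \<open>last_weight\<close> is the contribution of the rightmost child together with its
  parent.\<close>

definition young_weight :: "'r::comm_ring_1 \<Rightarrow> 'r \<Rightarrow> 'r \<Rightarrow> ptree \<Rightarrow> 'r" where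
  "young_weight y r q t = (if children t = [] then y else forest_weight y r q (children t))"

definition last_weight :: "'r::comm_ring_1 \<Rightarrow> 'r \<Rightarrow> 'r \<Rightarrow> ptree \<Rightarrow> 'r" where
  "last_weight y r q t = (if children t = [] then q else r * forest_weight y r q (children t))"

lemma forest_weight_single: "forest_weight y r q [t] = last_weight y r q t"
  by (cases t) (simp add: last_weight_def)

lemma forest_weight_Cons: "ts \<noteq> [] \<Longrightarrow> forest_weight y r q (t # ts) = young_weight y r q t * forest_weight y r q ts"
  by (cases t; cases ts) (simp_all add: young_weight_def)

text \<open>The series \<open>G\<close> of the opening comment: nonempty forests in which all labels
  are \<open>n\<close>, that is, what can be newly hung below a node.\<close>

definition top_gf :: "'r::comm_ring_1 \<Rightarrow> 'r \<Rightarrow> 'r \<Rightarrow> nat \<Rightarrow> 'r fps" where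
  "top_gf y r q n = gf (cnt n) (forest_weight y r q) (forest_fibre n [] - {[]})"

lemma Nil_in_forest_fibre: "[] \<in> forest_fibre n ts \<longleftrightarrow> ts = []"
  by (auto simp: forest_fibre_def)

text \<open>A childless node is paid for differently from a node with children, hence the separate
  weight \<open>a\<close> for the empty forest. That forest occurs only in the fibre over
  \<open>[]\<close>.\<close>

lemma gf_forest_fibre_split:
  assumes "0 < n"
  shows "gf (cnt n) (\<lambda>us. if us = [] then a else b * forest_weight y r q us) (forest_fibre n ts) =
    (if ts = [] then fps_const a + fps_const b * top_gf y r q n
     else fps_const b * gf (cnt n) (forest_weight y r q) (forest_fibre n ts))"
proof (cases "ts = []")
  case True
  let ?f = "\<lambda>us. if us = [] then a else b * forest_weight y r q us"
  have "forest_fibre n [] = {[]} \<union> (forest_fibre n [] - {[]})" using Nil_in_forest_fibre[of n] by auto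
  hence "gf (cnt n) ?f (forest_fibre n []) = gf (cnt n) ?f ({[]} \<union> (forest_fibre n [] - {[]}))" by simp
  also have "\<dots> = gf (cnt n) ?f {[]} + gf (cnt n) ?f (forest_fibre n [] - {[]})"
    by (rule gf_union) (auto intro!: graded_subset[OF graded_forest_fibre[OF assms, of "[]"]] simp: Nil_in_forest_fibre)
  also have "gf (cnt n) ?f {[]} = fps_const a" by (simp add: gf_singleton)
  also have "gf (cnt n) ?f (forest_fibre n [] - {[]}) = gf (cnt n) (\<lambda>us. b * forest_weight y r q us) (forest_fibre n [] - {[]})"
    by (rule gf_cong) auto
  finally show ?thesis using True by (simp add: gf_cmult top_gf_def)
next
  case False
  have "gf (cnt n) (\<lambda>us. if us = [] then a else b * forest_weight y r q us) (forest_fibre n ts) =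
    gf (cnt n) (\<lambda>us. b * forest_weight y r q us) (forest_fibre n ts)"
    by (rule gf_cong) (use False in \<open>auto simp: Nil_in_forest_fibre\<close>)
  thus ?thesis using False by (simp add: gf_cmult)
qed

lemma forest_fibre_labels:
  assumes "us \<in> forest_fibre n ts" "t \<in> set us"
  shows "label t = n \<or> (\<exists>t'\<in>set ts. label t' = label t)"
proof (cases "label t < n")
  case True
  hence "strip n t \<in> set ts" using assms by (auto simp: forest_fibre_def)
  thus ?thesis by force
next
  case False
  thus ?thesis using assms by (auto simp: forest_fibre_def forest_def dest!: valid_label_le bspec)
qed

lemma tree_fibre_Node:
  assumes "l < n" "\<forall>t\<in>set ts. l \<le> label t"
  shows "tree_fibre n (Node l ts) = Node l ` forest_fibre n ts"
proof (intro equalityI subsetI)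
  fix t' assume t': "t' \<in> tree_fibre n (Node l ts)"
  obtain l' us where eq: "t' = Node l' us" by (cases t')
  with t' have "l' = l" "us \<in> forest_fibre n ts" by (auto simp: tree_fibre_def forest_fibre_def)
  thus "t' \<in> Node l ` forest_fibre n ts" using eq by auto
next
  fix t' assume "t' \<in> Node l ` forest_fibre n ts"
  then obtain us where us: "us \<in> forest_fibre n ts" "t' = Node l us" by auto
  have "l \<le> label t" if "t \<in> set us" for t
    using forest_fibre_labels[OF us(1) that] assms by auto
  thus "t' \<in> tree_fibre n (Node l ts)" using us assms by (auto simp: tree_fibre_def forest_fibre_def)
qed

text \<open>A leaf stays a leaf or receives a nonempty forest labelled \<open>n\<close>. This gives
  \<open>y + G\<close> for a young leaf, and \<open>q + r G\<close> for an old leaf with its parent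
  as long as it remains the last child.\<close>

lemma gf_tree_fibre:
  assumes "l < n" "\<forall>t\<in>set ts. l \<le> label t"
  shows "gf (cntT n) (young_weight y r q) (tree_fibre n (Node l ts)) =
      (if ts = [] then fps_const y + top_gf y r q n else gf (cnt n) (forest_weight y r q) (forest_fibre n ts))"
    and "gf (cntT n) (last_weight y r q) (tree_fibre n (Node l ts)) =
      (if ts = [] then fps_const q + fps_const r * top_gf y r q n
       else fps_const r * gf (cnt n) (forest_weight y r q) (forest_fibre n ts))"
    and "graded (cntT n) (tree_fibre n (Node l ts))"
proof -
  have n: "0 < n" using assms by simp
  have b: "bij_betw (Node l) (forest_fibre n ts) (tree_fibre n (Node l ts))"
    unfolding tree_fibre_Node[OF assms] by (intro inj_on_imp_bij_betw inj_onI) simp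
  show "gf (cntT n) (young_weight y r q) (tree_fibre n (Node l ts)) =
      (if ts = [] then fps_const y + top_gf y r q n else gf (cnt n) (forest_weight y r q) (forest_fibre n ts))"
    using gf_bij[OF b, of "cntT n" "cnt n" 0 "young_weight y r q" "\<lambda>us. if us = [] then y else 1 * forest_weight y r q us"] assms(1)
    unfolding gf_forest_fibre_split[OF n] by (simp add: young_weight_def)
  show "gf (cntT n) (last_weight y r q) (tree_fibre n (Node l ts)) =
      (if ts = [] then fps_const q + fps_const r * top_gf y r q n
       else fps_const r * gf (cnt n) (forest_weight y r q) (forest_fibre n ts))"
    using gf_bij[OF b, of "cntT n" "cnt n" 0 "last_weight y r q" "\<lambda>us. if us = [] then q else r * forest_weight y r q us"] assms(1)
    unfolding gf_forest_fibre_split[OF n] by (simp add: last_weight_def)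
  show "graded (cntT n) (tree_fibre n (Node l ts))"
    unfolding tree_fibre_Node[OF assms] by (rule graded_image[OF graded_forest_fibre[OF n], where s = 0]) (use assms(1) in simp)
qed

definition top_trees :: "nat \<Rightarrow> ptree set" where
  "top_trees n = {t. valid n t \<and> label t = n}"

lemma top_trees_eq: "top_trees n = Node n ` forest_fibre n []"
proof (intro equalityI subsetI)
  fix t assume "t \<in> top_trees n"
  thus "t \<in> Node n ` forest_fibre n []" by (cases t) (auto simp: top_trees_def forest_fibre_def filter_empty_conv not_less)
next
  fix t assume "t \<in> Node n ` forest_fibre n []"
  thus "t \<in> top_trees n" by (auto simp: top_trees_def forest_fibre_def filter_empty_conv not_less)
qed

lemma gf_top_trees:
  assumes n: "0 < n"
  shows "gf (cntT n) (young_weight y r q) (top_trees n) = fps_X * (fps_const y + top_gf y r q n)"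
    and "gf (cntT n) (last_weight y r q) (top_trees n) = fps_X * (fps_const q + fps_const r * top_gf y r q n)"
    and "graded (cntT n) (top_trees n)"
proof -
  have b: "bij_betw (Node n) (forest_fibre n []) (top_trees n)"
    unfolding top_trees_eq by (intro inj_on_imp_bij_betw inj_onI) simp
  show "gf (cntT n) (young_weight y r q) (top_trees n) = fps_X * (fps_const y + top_gf y r q n)"
    using gf_bij[OF b, of "cntT n" "cnt n" 1 "young_weight y r q" "\<lambda>us. if us = [] then y else 1 * forest_weight y r q us"]
    unfolding gf_forest_fibre_split[OF n] by (simp add: young_weight_def)
  show "gf (cntT n) (last_weight y r q) (top_trees n) = fps_X * (fps_const q + fps_const r * top_gf y r q n)"
    using gf_bij[OF b, of "cntT n" "cnt n" 1 "last_weight y r q" "\<lambda>us. if us = [] then q else r * forest_weight y r q us"]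
    unfolding gf_forest_fibre_split[OF n] by (simp add: last_weight_def)
  show "graded (cntT n) (top_trees n)"
    unfolding top_trees_eq by (rule graded_image[OF graded_forest_fibre[OF n], where s = 1]) simp
qed

lemma gf_Cons:
  assumes "graded (cntT n) S" "graded (cnt n) T" "[] \<notin> T"
  shows "gf (cnt n) (forest_weight y r q) ((\<lambda>(t, us). t # us) ` (S \<times> T)) =
    gf (cntT n) (young_weight y r q) S * gf (cnt n) (forest_weight y r q) T"
proof (rule gf_prod[where h = "\<lambda>t us. t # us"])
  show "bij_betw (\<lambda>(t, us). t # us) (S \<times> T) ((\<lambda>(t, us). t # us) ` (S \<times> T))"
    by (intro inj_on_imp_bij_betw inj_onI) auto
qed (use assms in \<open>auto intro: forest_weight_Cons\<close>)

lemma graded_Cons: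
  assumes "graded (cntT n) S" "graded (cnt n) T"
  shows "graded (cnt n) ((\<lambda>(t, us). t # us) ` (S \<times> T))"
  unfolding graded_def
proof (rule allI)
  fix p
  have "{us \<in> (\<lambda>(t, us). t # us) ` (S \<times> T). cnt n us = p} \<subseteq>
    (\<lambda>(t, us). t # us) ` (\<Union>i\<in>{..p}. {t\<in>S. cntT n t = i} \<times> {us\<in>T. cnt n us = p - i})"
    by force
  moreover have "finite \<dots>" using assms by (auto simp: graded_def)
  ultimately show "finite {us \<in> (\<lambda>(t, us). t # us) ` (S \<times> T). cnt n us = p}"
    by (rule finite_subset)
qed

text \<open>If nothing follows the first tree, it is the last child and contributes
  \<open>last_weight\<close>. Otherwise a tree with root \<open>n\<close> is last and the first tree
  contributes \<open>young_weight\<close>; an old leaf can turn young in this way.\<close>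

lemma gf_single_or_Cons:
  assumes n: "0 < n" and S: "graded (cntT n) S"
  shows "gf (cnt n) (forest_weight y r q) ((\<lambda>(t, us). t # us) ` (S \<times> forest_fibre n [])) =
    gf (cntT n) (last_weight y r q) S + gf (cntT n) (young_weight y r q) S * top_gf y r q n"
proof -
  let ?T = "forest_fibre n [] - {[]}"
  have T: "graded (cnt n) ?T" by (rule graded_subset[OF graded_forest_fibre[OF n, of "[]"]]) auto
  have "(\<lambda>(t, us). t # us) ` (S \<times> forest_fibre n []) =
    (\<lambda>t. [t]) ` S \<union> (\<lambda>(t, us). t # us) ` (S \<times> ?T)"
    using Nil_in_forest_fibre[of n "[]"] by (auto simp: image_iff)
  also have "gf (cnt n) (forest_weight y r q) \<dots> = gf (cnt n) (forest_weight y r q) ((\<lambda>t. [t]) ` S) +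
      gf (cnt n) (forest_weight y r q) ((\<lambda>(t, us). t # us) ` (S \<times> ?T))"
    by (rule gf_union) (auto intro!: graded_Cons S T graded_image[OF S, where s = 0])
  also have "gf (cnt n) (forest_weight y r q) ((\<lambda>t. [t]) ` S) = fps_X ^ 0 * gf (cntT n) (last_weight y r q) S"
    by (rule gf_bij[where h = "\<lambda>t. [t]"]) (auto intro!: inj_on_imp_bij_betw inj_onI simp: forest_weight_single)
  finally show ?thesis by (simp add: gf_Cons[OF S T] top_gf_def)
qed

lemma forest_fibre_Nil_Cons: "forest_fibre n [] - {[]} = (\<lambda>(t, us). t # us) ` (top_trees n \<times> forest_fibre n [])"
proof (intro equalityI subsetI)
  fix us assume us: "us \<in> forest_fibre n [] - {[]}"
  then obtain t vs where eq: "us = t # vs" by (cases us) auto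
  have "label t = n" using us forest_fibre_labels[of us n "[]" t] eq by auto
  hence "t \<in> top_trees n" "vs \<in> forest_fibre n []" using us eq by (auto simp: top_trees_def forest_fibre_def)
  thus "us \<in> (\<lambda>(t, us). t # us) ` (top_trees n \<times> forest_fibre n [])" using eq by auto
next
  fix us assume "us \<in> (\<lambda>(t, us). t # us) ` (top_trees n \<times> forest_fibre n [])"
  then obtain t vs where *: "us = t # vs" "t \<in> top_trees n" "vs \<in> forest_fibre n []" by auto
  have "label t' = n" if "t' \<in> set vs" for t' using forest_fibre_labels[OF *(3) that] by auto
  thus "us \<in> forest_fibre n [] - {[]}" using * by (auto simp: top_trees_def forest_fibre_def)
qed

text \<open>Splits off the first tree: it is either the last one, too, or followed by a nonempty
  forest.\<close>

lemma top_gf_eq: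
  assumes n: "0 < n"
  shows "top_gf y r q n = fps_X * (fps_const q + (fps_const y + fps_const r) * top_gf y r q n + top_gf y r q n ^ 2)"
proof -
  have "top_gf y r q n = fps_X * (fps_const q + fps_const r * top_gf y r q n) +
      fps_X * (fps_const y + top_gf y r q n) * top_gf y r q n"
    using gf_single_or_Cons[OF n gf_top_trees(3)[OF n], of y r q]
    unfolding forest_fibre_Nil_Cons[symmetric] gf_top_trees[OF n] top_gf_def[symmetric] .
  thus ?thesis by (simp add: algebra_simps power2_eq_square del: fps_const_add)
qed

text \<open>Siblings are sorted, so trees with root \<open>n\<close> come after all others; the
  first tree of a larger forest must therefore strip to \<open>t\<close>.\<close>

lemma forest_fibre_Cons:
  assumes "label t < n" "\<forall>t'\<in>set ts. label t \<le> label t'"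
  shows "forest_fibre n (t # ts) = (\<lambda>(t, us). t # us) ` (tree_fibre n t \<times> forest_fibre n ts)"
proof (intro equalityI subsetI)
  fix us assume us: "us \<in> forest_fibre n (t # ts)"
  then obtain t' vs where eq: "us = t' # vs" by (cases us) (auto simp: forest_fibre_def)
  have "label t' < n"
  proof (rule ccontr)
    assume "\<not> label t' < n"
    hence "filter (\<lambda>t. label t < n) us = []" using us eq by (auto simp: forest_fibre_def filter_empty_conv)
    thus False using us by (simp add: forest_fibre_def)
  qed
  hence "t' \<in> tree_fibre n t" "vs \<in> forest_fibre n ts" using us eq by (auto simp: tree_fibre_def forest_fibre_def)
  thus "us \<in> (\<lambda>(t, us). t # us) ` (tree_fibre n t \<times> forest_fibre n ts)" using eq by auto
next
  fix us assume "us \<in> (\<lambda>(t, us). t # us) ` (tree_fibre n t \<times> forest_fibre n ts)"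
  then obtain t' vs where *: "us = t' # vs" "t' \<in> tree_fibre n t" "vs \<in> forest_fibre n ts" by auto
  have t': "label t' = label t" using *(2) by (auto simp: tree_fibre_def)
  have "label t' \<le> label u" if "u \<in> set vs" for u
    using forest_fibre_labels[OF *(3) that] assms t' by auto
  thus "us \<in> forest_fibre n (t # ts)" using * by (auto simp: tree_fibre_def forest_fibre_def)
qed

text \<open>The forests hung below different nodes are independent, so every factor of the weight is
  replaced by its own series. At a last child, \<open>gf_single_or_Cons\<close> yields
  \<open>(q + r G) + (y + G) G\<close> for a leaf and \<open>r W + W G = (r + G) W\<close> for a
  tree whose children contribute \<open>W\<close>.\<close>

lemma gf_forest_fibre:
  assumes n: "0 < n" and "forest n ts" "n \<notin># forest_labels ts"
  shows "gf (cnt n) (forest_weight y r q) (forest_fibre n ts) =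
    forest_weight (fps_const y + top_gf y r q n) (fps_const r + top_gf y r q n)
      (fps_const q + (fps_const y + fps_const r) * top_gf y r q n + top_gf y r q n ^ 2) ts"
  using assms(2,3)
proof (induction y r q ts rule: forest_weight.induct)
  case (1 y r q)
  have "gf (cnt n) (forest_weight y r q) (forest_fibre n []) =
      gf (cnt n) (\<lambda>us. if us = [] then r else 1 * forest_weight y r q us) (forest_fibre n [])"
    by (rule gf_cong) simp
  thus ?case unfolding gf_forest_fibre_split[OF n] by simp
next
  case (2 y r q l cs)
  have l: "l < n" "\<forall>t\<in>set cs. l \<le> label t" using 2 by auto
  have "forest_fibre n [Node l cs] = (\<lambda>(t, us). t # us) ` (tree_fibre n (Node l cs) \<times> forest_fibre n [])"
    using l by (intro forest_fibre_Cons) auto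
  thus ?case using 2 gf_tree_fibre(1,2)[OF l, of y r q]
    by (simp add: gf_single_or_Cons[OF n gf_tree_fibre(3)[OF l]] algebra_simps power2_eq_square
        del: fps_const_add)
next
  case (3 y r q l cs t ts)
  have l: "l < n" "\<forall>t\<in>set cs. l \<le> label t" using 3 by auto
  have "forest_fibre n (Node l cs # t # ts) = (\<lambda>(t, us). t # us) ` (tree_fibre n (Node l cs) \<times> forest_fibre n (t # ts))"
    using l 3 by (intro forest_fibre_Cons) auto
  thus ?case using 3 gf_tree_fibre(1)[OF l, of y r q]
    by (simp add: gf_Cons[OF gf_tree_fibre(3)[OF l] graded_forest_fibre[OF n]] Nil_in_forest_fibre)
qed

section \<open>The polynomial of all forests with given labels\<close>

definition forests :: "nat multiset \<Rightarrow> ptree list set" where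
  "forests M = {ts. Node 0 ts \<in> weakly_increasing_trees M}"

lemma forests_iff: "ts \<in> forests M \<longleftrightarrow> forest_labels ts = M \<and> increasing (Node 0 ts)"
  by (simp add: forests_def weakly_increasing_trees_def)

lemma finite_forests: "finite (forests M)"
proof -
  have "Node 0 ` forests M \<subseteq> weakly_increasing_trees M" by (auto simp: forests_def)
  hence "finite (Node 0 ` forests M)" by (rule finite_subset) (rule finite_weakly_increasing_trees)
  thus ?thesis by (rule finite_imageD) (auto intro: inj_onI)
qed

lemma forest_eq: "forest n ts \<longleftrightarrow> increasing (Node 0 ts) \<and> set_mset (forest_labels ts) \<subseteq> {..n}"
  by (auto simp: forest_def valid_def set_forest_labels)

definition forest_poly :: "nat multiset \<Rightarrow> 'r::comm_ring_1 \<Rightarrow> 'r \<Rightarrow> 'r \<Rightarrow> 'r" where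
  "forest_poly M y r q = (\<Sum>ts\<in>forests M. forest_weight y r q ts)"

text \<open>Deleting the nodes labelled \<open>n\<close> sorts the larger forests by the smaller
  forest from which they arise; the union is disjoint because deletion is a function.\<close>

lemma forests_insert:
  assumes n: "0 < n" and M: "\<forall>x\<in>#M. x < n"
  shows "forests (M + replicate_mset p n) = (\<Union>ts\<in>forests M. {us\<in>forest_fibre n ts. cnt n us = p})"
proof (intro equalityI subsetI)
  fix us assume us: "us \<in> forests (M + replicate_mset p n)"
  have M0: "filter_mset (\<lambda>x. x < n) M = M" "count M n = 0"
    using M by (auto simp: filter_mset_eq_conv count_eq_zero_iff)
  have lu: "forest_labels us = M + replicate_mset p n" using us by (simp add: forests_iff)
  have f: "forest n us" using us M by (force simp: forest_eq forests_iff split: if_splits)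
  have "forest_labels (strip_forest n us) = M" 
    using forest_labels_strip_forest[OF n f] lu M0 by simp
  moreover have "forest n (strip_forest n us)" 
  proof -
    have "valid n t \<Longrightarrow> valid n (strip n t)" for t
    proof (induction t)
      case (Node l vs)
      thus ?case by (auto simp: forest_def comp_def sorted_filter simp del: strip.simps(1) simp: strip.simps)
    qed
    thus ?thesis using f by (auto simp: forest_def comp_def intro: sorted_filter)
  qed
  ultimately have "strip_forest n us \<in> forests M" by (simp add: forests_iff forest_eq)
  moreover have "us \<in> forest_fibre n (strip_forest n us)" using f by (simp add: forest_fibre_def)
  moreover have "cnt n us = p" using lu M0 by simp
  ultimately show "us \<in> (\<Union>ts\<in>forests M. {us\<in>forest_fibre n ts. cnt n us = p})" by blast
next
  fix us assume "us \<in> (\<Union>ts\<in>forests M. {us\<in>forest_fibre n ts. cnt n us = p})"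
  then obtain ts where ts: "ts \<in> forests M" "us \<in> forest_fibre n ts" "cnt n us = p" by blast
  have "forest_labels us = M + replicate_mset p n"
    using forest_labels_forest_fibre[OF n ts(2)] ts by (simp add: forests_iff)
  thus "us \<in> forests (M + replicate_mset p n)"
    using ts by (auto simp: forests_iff forest_fibre_def forest_eq)
qed

lemma forest_poly_insert:
  assumes n: "0 < n" and M: "\<forall>x\<in>#M. x < n"
  shows "forest_poly (M + replicate_mset p n) y r q =
    fps_nth (forest_poly M (fps_const y + top_gf y r q n) (fps_const r + top_gf y r q n)
      (fps_const q + (fps_const y + fps_const r) * top_gf y r q n + top_gf y r q n ^ 2)) p"
proof -
  have "forest_poly (M + replicate_mset p n) y r q =
    (\<Sum>ts\<in>forests M. \<Sum>us\<in>{us\<in>forest_fibre n ts. cnt n us = p}. forest_weight y r q us)"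
    unfolding forest_poly_def forests_insert[OF assms]
    by (rule sum.UNION_disjoint)
       (use graded_forest_fibre[OF n] in \<open>auto simp: finite_forests graded_def forest_fibre_def\<close>)
  also have "\<dots> = (\<Sum>ts\<in>forests M. fps_nth (gf (cnt n) (forest_weight y r q) (forest_fibre n ts)) p)"
    by (simp add: gf_nth)
  also have "\<dots> = (\<Sum>ts\<in>forests M. fps_nth (forest_weight (fps_const y + top_gf y r q n) (fps_const r + top_gf y r q n)
      (fps_const q + (fps_const y + fps_const r) * top_gf y r q n + top_gf y r q n ^ 2) ts) p)"
  proof (rule sum.cong)
    fix ts assume "ts \<in> forests M"
    hence "forest n ts" "n \<notin># forest_labels ts" using M by (auto simp: forests_iff forest_eq less_imp_le)
    thus "fps_nth (gf (cnt n) (forest_weight y r q) (forest_fibre n ts)) p = fps_nth (forest_weight (fps_const y + top_gf y r q n) (fps_const r + top_gf y r q n)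
      (fps_const q + (fps_const y + fps_const r) * top_gf y r q n + top_gf y r q n ^ 2) ts) p"
      by (simp add: gf_forest_fibre[OF n])
  qed simp
  finally show ?thesis by (simp add: forest_poly_def fps_sum_nth)
qed

section \<open>Lagrange inversion\<close>

text \<open>The derivative in the polynomial variable \<open>s\<close>. It commutes with
  \<open>fps_deriv\<close>, the derivative in the marking variable \<open>z = fps_X\<close>.\<close>

definition fps_pderiv :: "real poly fps \<Rightarrow> real poly fps" where
  "fps_pderiv F = Abs_fps (\<lambda>p. pderiv (fps_nth F p))"

lemma fps_pderiv_nth [simp]: "fps_nth (fps_pderiv F) p = pderiv (fps_nth F p)"
  by (simp add: fps_pderiv_def)

lemma fps_pderiv_add [simp]: "fps_pderiv (F + G) = fps_pderiv F + fps_pderiv G"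
  by (rule fps_ext) (simp add: pderiv_add)

lemma fps_pderiv_mult [simp]: "fps_pderiv (F * G) = F * fps_pderiv G + fps_pderiv F * G"
proof (rule fps_ext)
  have "pderiv (a * b) = a * pderiv b + pderiv a * b" for a b :: "real poly"
    by (simp add: pderiv_mult)
  thus "fps_nth (fps_pderiv (F * G)) p = fps_nth (F * fps_pderiv G + fps_pderiv F * G) p" for p
    by (simp add: fps_mult_nth higher_pderiv_sum[where n = 1, simplified] sum.distrib)
qed

lemma fps_pderiv_const [simp]: "fps_pderiv (fps_const a) = fps_const (pderiv a)"
  by (rule fps_ext) simp

lemma fps_pderiv_X [simp]: "fps_pderiv fps_X = 0"
  by (rule fps_ext) (simp add: fps_X_def)

lemma fps_pderiv_deriv: "fps_pderiv (fps_deriv F) = fps_deriv (fps_pderiv F)"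
  by (rule fps_ext) (simp add: pderiv_mult pderiv_add ring_distribs)

lemma fps_pderiv_funpow_deriv:
  "fps_deriv ((fps_pderiv ^^ p) F) = (fps_pderiv ^^ p) (fps_deriv F)"
  by (induction p) (simp_all add: fps_pderiv_deriv[symmetric])

lemma fps_pderiv_funpow_nth: "fps_nth ((fps_pderiv ^^ p) F) i = (pderiv ^^ p) (fps_nth F i)"
  by (induction p) simp_all

text \<open>For \<open>H = s + z P(H)\<close> this ring contains all power series that depend on \<open>s\<close> and \<open>z\<close>
  through \<open>H\<close> only; it replaces the composition of a polynomial with \<open>H\<close>.\<close>

definition along :: "real poly fps \<Rightarrow> real poly fps set" where
  "along P = {F. fps_deriv F = P * fps_pderiv F}"

lemma along_add: "F \<in> along P \<Longrightarrow> G \<in> along P \<Longrightarrow> F + G \<in> along P"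
  by (simp add: along_def ring_distribs)

lemma along_mult: "F \<in> along P \<Longrightarrow> G \<in> along P \<Longrightarrow> F * G \<in> along P"
  by (simp add: along_def ring_distribs mult_ac)

lemma along_const: "pderiv a = 0 \<Longrightarrow> fps_const a \<in> along P"
  by (simp add: along_def)

lemma along_power: "F \<in> along P \<Longrightarrow> F ^ i \<in> along P"
  by (induction i) (auto intro: along_mult along_const[of 1, simplified])

lemma along_sum: "(\<And>x. x \<in> S \<Longrightarrow> f x \<in> along P) \<Longrightarrow> sum f S \<in> along P"
  by (induction S rule: infinite_finite_induct)
     (auto intro: along_add along_const[of 0, simplified])

lemma along_forest_weight:
  assumes "y \<in> along P" "r \<in> along P" "q \<in> along P"
  shows "forest_weight y r q ts \<in> along P"
  using assms by (induction y r q ts rule: forest_weight.induct) (auto intro: along_mult)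

text \<open>Each derivative in \<open>z\<close> is traded for one in \<open>s\<close> and one factor
  \<open>P\<close>. Since \<open>P ^ p\<close> and \<open>F\<close> both lie in
  \<open>along P\<close>, the product rule gives \<open>fps_deriv (P ^ p * fps_pderiv F) =
  fps_pderiv (P ^ Suc p * fps_pderiv F)\<close>.\<close>

lemma along_nth_deriv:
  assumes P: "P \<in> along P" and F: "F \<in> along P"
  shows "fps_nth_deriv p (fps_pderiv F) = (fps_pderiv ^^ p) (P ^ p * fps_pderiv F)"
proof (induction p)
  case (Suc p)
  have "fps_deriv (P ^ p * fps_pderiv F) =
      P ^ p * fps_pderiv (fps_deriv F) + fps_deriv (P ^ p) * fps_pderiv F"
    by (simp add: fps_pderiv_deriv)
  also have "\<dots> = fps_pderiv (P ^ p * (P * fps_pderiv F))"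
    using F along_power[OF P, of p] unfolding along_def
    by (simp add: algebra_simps)
  finally show ?case
    by (simp only: fps_nth_deriv_commute Suc.IH fps_pderiv_funpow_deriv funpow_Suc_right o_apply
        power_Suc2 mult.assoc)
qed simp

text \<open>Lagrange inversion in differentiated form: the constant term in \<open>z\<close> of the
  preceding identity, whose left side is a Maclaurin coefficient.\<close>

lemma lagrange_pderiv:
  assumes P: "P \<in> along P" and F: "F \<in> along P"
  shows "fact p * pderiv (fps_nth F p) = (pderiv ^^ p) (fps_nth P 0 ^ p * pderiv (fps_nth F 0))"
proof -
  have "fps_nth (fps_nth_deriv p (fps_pderiv F)) 0 = fact p * pderiv (fps_nth F p)"
    by (simp add: fps_deriv_maclauren_0)
  thus ?thesis unfolding along_nth_deriv[OF assms] 
    by (simp add: fps_pderiv_funpow_nth fps_power_zeroth)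
qed

text \<open>Differentiating the equation for \<open>H\<close> in \<open>z\<close> and in
  \<open>s\<close> gives the same factor \<open>1 - z (2 H + 1)\<close> times the derivative, with
  right sides \<open>H ^ 2 + H\<close> and 1. Eliminating this factor relates the two
  derivatives.\<close>

lemma along_fixpoint:
  assumes H: "H = fps_const [:0, 1:] + fps_X * (H ^ 2 + H)"
  shows "H \<in> along (H ^ 2 + H)"
proof -
  let ?P = "H ^ 2 + H"
  have z: "fps_deriv H = ?P + fps_X * (2 * H + 1) * fps_deriv H"
    by (subst H) (simp add: power2_eq_square algebra_simps)
  have "fps_pderiv H = fps_pderiv (fps_const [:0, 1:] + fps_X * (H * H + H))"
    using H by (simp only: power2_eq_square)
  also have "\<dots> = 1 + fps_X * (2 * H + 1) * fps_pderiv H"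
    by (simp only: fps_pderiv_add fps_pderiv_mult fps_pderiv_X fps_pderiv_const)
       (simp add: pderiv_pCons algebra_simps flip: one_pCons)
  finally have s: "(1 - fps_X * (2 * H + 1)) * fps_pderiv H = 1" by (simp add: algebra_simps)
  have "fps_deriv H = fps_deriv H * ((1 - fps_X * (2 * H + 1)) * fps_pderiv H)" using s by simp
  also have "\<dots> = (fps_deriv H - fps_X * (2 * H + 1) * fps_deriv H) * fps_pderiv H"
    by (simp add: algebra_simps)
  also have "fps_deriv H - fps_X * (2 * H + 1) * fps_deriv H = ?P" using z by (simp add: algebra_simps)
  finally show ?thesis by (simp add: along_def)
qed

section \<open>The insertion operator on forest polynomials\<close>

abbreviation phi :: "real poly" where "phi \<equiv> [:0, 1, 1:]"

text \<open>The polynomial variable is \<open>s\<close>; evaluation at \<open>s = c\<close> gives young leaves weight \<open>0\<close>.\<close>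

definition shifted_forest_poly :: "real \<Rightarrow> nat multiset \<Rightarrow> real poly" where
  "shifted_forest_poly c M = forest_poly M [:- c, 1:] [:1 + c, 1:] phi"

text \<open>Here \<open>y\<close> and \<open>r\<close> are \<open>s\<close> plus constants and
  \<open>y + r = 1 + 2 s\<close>. Hence with \<open>H = s + G\<close> the three substituted weights
  become \<open>H - c\<close>, \<open>H + 1 + c\<close> and \<open>H ^ 2 + H\<close>, all in
  \<open>along (H ^ 2 + H)\<close>, and Lagrange inversion applies to the forest polynomial.\<close>

lemma shifted_forest_poly_insert:
  assumes n: "0 < n" and M: "\<forall>x\<in>#M. x < n"
  shows "fact p * pderiv (shifted_forest_poly c (M + replicate_mset p n)) = (pderiv ^^ p) (phi ^ p * pderiv (shifted_forest_poly c M))"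
    and "shifted_forest_poly c (add_mset n M) = phi * pderiv (shifted_forest_poly c M)"
proof -
  define G where "G = top_gf [:- c, 1:] [:1 + c, 1:] phi n"
  define H where "H = fps_const [:0, 1:] + G"
  define F where "F = forest_poly M (fps_const [:- c, 1:] + G) (fps_const [:1 + c, 1:] + G)
      (fps_const phi + (fps_const [:- c, 1:] + fps_const [:1 + c, 1:]) * G + G ^ 2)"
  have c: "fps_const [:- c, 1:] + G = H + fps_const [:- c:]"
    "fps_const [:1 + c, 1:] + G = H + fps_const [:1 + c:]"
    by (simp_all add: H_def add_ac)
  have H2: "fps_const phi + (fps_const [:- c, 1:] + fps_const [:1 + c, 1:]) * G + G ^ 2 = H ^ 2 + H"
  proof -
    have "H ^ 2 + H = fps_const ([:0, 1:] * [:0, 1:] + [:0, 1:]) + 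
      fps_const ([:0, 1:] + [:0, 1:] + 1) * G + G ^ 2"
      unfolding H_def fps_const_mult[symmetric] fps_const_add[symmetric]
      by (simp add: power2_eq_square algebra_simps del: fps_const_add fps_const_mult)
    also have "([:0, 1:] * [:0, 1:] + [:0, 1:]) = phi" by simp
    also have "[:0, 1:] + [:0, 1:] + 1 = [:- c, 1:] + [:1 + c, 1:]" by (simp add: one_pCons)
    finally show ?thesis by simp
  qed
  have "H = fps_const [:0, 1:] + fps_X * (H ^ 2 + H)"
    using top_gf_eq[OF n, of "[:- c, 1:]" "[:1 + c, 1:]" phi] H2 by (simp add: G_def[symmetric] H_def)
  hence Hk: "H \<in> along (H ^ 2 + H)" by (rule along_fixpoint)
  hence Pk: "H ^ 2 + H \<in> along (H ^ 2 + H)" by (intro along_add along_power)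
  have Fk: "F \<in> along (H ^ 2 + H)"
    unfolding F_def H2 c forest_poly_def
    by (intro along_sum along_forest_weight along_add Hk Pk along_const) simp_all
  have Fp: "fps_nth F p = shifted_forest_poly c (M + replicate_mset p n)" for p
    by (simp add: F_def shifted_forest_poly_def G_def forest_poly_insert[OF n M])
  have F0: "fps_nth F 0 = shifted_forest_poly c M" using Fp[of 0] by simp
  have G0: "fps_nth G 0 = 0"
    unfolding G_def by (subst top_gf_eq[OF n]) simp
  have P0: "fps_nth (H ^ 2 + H) 0 = phi" by (simp add: H_def G0 power2_eq_square)
  show "fact p * pderiv (shifted_forest_poly c (M + replicate_mset p n)) = (pderiv ^^ p) (phi ^ p * pderiv (shifted_forest_poly c M))"
    using lagrange_pderiv[OF Pk Fk, of p] by (simp only: Fp[of p] F0 P0)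
  \<comment> \<open>For a single new label the equation defining \<open>along\<close>, taken at
    \<open>z = 0\<close>, gives the polynomial itself; the first claim with \<open>p = 1\<close>
    would determine it only up to a constant.\<close>
  have "fps_nth (fps_deriv F) 0 = fps_nth ((H ^ 2 + H) * fps_pderiv F) 0"
    using Fk by (simp add: along_def)
  thus "shifted_forest_poly c (add_mset n M) = phi * pderiv (shifted_forest_poly c M)"
    using P0 F0 Fp[of 1] by (simp del: fps_add_nth)
qed

lemma forests_empty: "forests {#} = {[]}"
proof -
  have "forest_labels ts \<noteq> {#}" if "ts \<noteq> []" for ts
    using that by (cases ts; cases "hd ts") auto
  hence "ts = []" if "forest_labels ts = {#}" for ts using that by blast
  thus ?thesis by (auto simp: forests_iff)
qed

lemma shifted_forest_poly_empty: "shifted_forest_poly c {#} = [:1 + c, 1:]"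
  by (simp add: shifted_forest_poly_def forest_poly_def forests_empty)

section \<open>Reading off leaves and young leaves from the weight\<close>

abbreviation nleaves :: "ptree list \<Rightarrow> nat" where "nleaves ts \<equiv> leaves (Node 0 ts)"
abbreviation nyoung :: "ptree list \<Rightarrow> nat" where "nyoung ts \<equiv> young_leaves (Node 0 ts)"

text \<open>The witness \<open>i\<close> counts the old leaves, and \<open>e\<close> the nodes that
  are neither leaves nor parents of an old leaf. A parent has at most one old leaf, so each
  \<open>q\<close> stands for two nodes; the last equation counts all nodes including the
  root.\<close>

lemma forest_weight_monomial:
  "\<exists>i e. forest_weight y r q ts = y ^ nyoung ts * q ^ i * r ^ e \<and> nleaves ts = nyoung ts + i \<and>
     size (forest_labels ts) + 1 = nyoung ts + 2 * i + e"
proof (induction y r q ts rule: forest_weight.induct)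
  case (1 y r q)
  show ?case by (intro exI[of _ 0] exI[of _ 1]) simp
next
  case (2 y r q l cs)
  show ?case
  proof (cases "cs = []")
    case True
    thus ?thesis by (intro exI[of _ 1] exI[of _ 0]) simp
  next
    case False
    then obtain i e where "forest_weight y r q cs = y ^ nyoung cs * q ^ i * r ^ e" "nleaves cs = nyoung cs + i"
     "size (forest_labels cs) + 1 = nyoung cs + 2 * i + e" using 2 by blast
    thus ?thesis using False by (intro exI[of _ i] exI[of _ "Suc e"]) simp
  qed
next
  case (3 y r q l cs t ts)
  obtain i e where *: "forest_weight y r q (t # ts) = y ^ nyoung (t # ts) * q ^ i * r ^ e"
    "nleaves (t # ts) = nyoung (t # ts) + i"
    "size (forest_labels (t # ts)) + 1 = nyoung (t # ts) + 2 * i + e" using 3 by blast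
  show ?case
  proof (cases "cs = []")
    case True
    hence "nyoung (Node l cs # t # ts) = Suc (nyoung (t # ts))"
      "nleaves (Node l cs # t # ts) = Suc (nleaves (t # ts))" by simp_all
    thus ?thesis using True * by (intro exI[of _ i] exI[of _ e]) (simp del: leaves.simps young_leaves.simps)
  next
    case False
    then obtain i' e' where **: "forest_weight y r q cs = y ^ nyoung cs * q ^ i' * r ^ e'" "nleaves cs = nyoung cs + i'"
     "size (forest_labels cs) + 1 = nyoung cs + 2 * i' + e'" using 3 by blast
    have "nyoung (Node l cs # t # ts) = nyoung cs + nyoung (t # ts)"
      "nleaves (Node l cs # t # ts) = nleaves cs + nleaves (t # ts)" using False by simp_all
    thus ?thesis using False * **
      by (intro exI[of _ "i + i'"] exI[of _ "e + e'"])
         (simp del: leaves.simps young_leaves.simps add: power_add mult_ac)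
  qed
qed

lemma forest_weight_no_young:
  assumes "nyoung ts = 0"
  shows "forest_weight 0 r q ts = q ^ nleaves ts * r ^ (size (forest_labels ts) + 1 - 2 * nleaves ts)"
    and "2 * nleaves ts \<le> size (forest_labels ts) + 1"
proof -
  obtain i e where "forest_weight 0 r q ts = 0 ^ nyoung ts * q ^ i * r ^ e" "nleaves ts = nyoung ts + i"
    "size (forest_labels ts) + 1 = nyoung ts + 2 * i + e" using forest_weight_monomial[of 0 r q ts] by blast
  with assms show "forest_weight 0 r q ts = q ^ nleaves ts * r ^ (size (forest_labels ts) + 1 - 2 * nleaves ts)"
    "2 * nleaves ts \<le> size (forest_labels ts) + 1"
    by (simp_all del: leaves.simps young_leaves.simps)
qed

lemma forest_weight_young: "nyoung ts \<noteq> 0 \<Longrightarrow> forest_weight 0 r q ts = 0"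
  using forest_weight_monomial[of 0 r q ts] by (auto simp: zero_power simp del: leaves.simps young_leaves.simps)

lemma leaves_pos: "children t \<noteq> [] \<Longrightarrow> 0 < leaves t"
proof (induction t)
  case (Node l ts)
  then obtain t where t: "t \<in> set ts" by (cases ts) auto
  show ?case
  proof (cases "children t = []")
    case True
    thus ?thesis using t by (auto simp: filter_empty_conv)
  next
    case False
    hence "0 < leaves t" using Node t by blast
    hence "0 < (\<Sum>t\<leftarrow>ts. leaves t)" using t member_le_sum_list[of "leaves t" "map leaves ts"] by auto
    thus ?thesis by simp
  qed
qed

lemma poly_forest_weight:
  fixes y r q :: "real poly"
  shows "poly (forest_weight y r q ts) x = forest_weight (poly y x) (poly r x) (poly q x) ts"
  by (induction y r q ts rule: forest_weight.induct) simp_all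

text \<open>At \<open>s = c\<close> the weights are \<open>y = 0\<close>, \<open>r = 1 + 2 c\<close>
  and \<open>q = c + c ^ 2\<close>. Only forests without young leaves survive, and their weight
  depends on the number of leaves alone.\<close>

lemma poly_shifted_forest_poly_diag:
  assumes "M \<noteq> {#}"
  shows "poly (shifted_forest_poly c M) c = (\<Sum>i=0..(size M - 1) div 2. 
    of_nat (tree_gamma M i) * (c + c ^ 2) ^ (i + 1) * (1 + 2 * c) ^ (size M - 1 - 2 * i))"
proof -
  define r q where "r = 1 + 2 * c" and "q = c + c ^ 2"
  define S where "S = {ts \<in> forests M. nyoung ts = 0}"
  define K where "K = (size M - 1) div 2"
  have finS: "finite S" by (simp add: S_def finite_forests del: young_leaves.simps)
  \<comment> \<open>A nonempty label multiset forces at least one leaf, so the truncated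
    \<open>nleaves ts - 1\<close> is faithful; the upper bound holds because every old leaf uses up
    two nodes.\<close>
  have leaf: "nleaves ts - 1 \<in> {0..K} \<and> nleaves ts = nleaves ts - 1 + 1" if "ts \<in> S" for ts
  proof -
    have "ts \<noteq> []" "forest_labels ts = M" "nyoung ts = 0" using that assms
      by (auto simp: S_def forests_iff simp del: young_leaves.simps)
    thus ?thesis using leaves_pos[of "Node 0 ts"] forest_weight_no_young(2)[of ts]
      by (auto simp: K_def simp del: young_leaves.simps leaves.simps)
  qed
  have "poly (shifted_forest_poly c M) c = (\<Sum>ts\<in>forests M. forest_weight 0 r q ts)"
    by (simp add: shifted_forest_poly_def forest_poly_def poly_sum poly_forest_weight r_def q_def algebra_simps power2_eq_square)
  also have "\<dots> = (\<Sum>ts\<in>S. forest_weight 0 r q ts)"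
    by (rule sum.mono_neutral_right) (auto simp: S_def finite_forests forest_weight_young simp del: young_leaves.simps)
  also have "\<dots> = (\<Sum>i=0..K. \<Sum>ts\<in>{ts\<in>S. nleaves ts - 1 = i}. forest_weight 0 r q ts)"
    by (rule sum.group[symmetric]) (use finS leaf in auto)
  also have "\<dots> = (\<Sum>i=0..K. of_nat (tree_gamma M i) * q ^ (i + 1) * r ^ (size M - 1 - 2 * i))"
  proof (rule sum.cong)
    fix i assume i: "i \<in> {0..K}"
    let ?S = "{ts\<in>S. nleaves ts - 1 = i}"
    have "bij_betw (Node 0) ?S {t \<in> weakly_increasing_trees M. leaves t = i + 1 \<and> young_leaves t = 0}"
      unfolding bij_betw_def
    proof
      show "Node 0 ` ?S = {t \<in> weakly_increasing_trees M. leaves t = i + 1 \<and> young_leaves t = 0}"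
      proof (intro equalityI subsetI)
        fix t assume "t \<in> Node 0 ` ?S"
        thus "t \<in> {t \<in> weakly_increasing_trees M. leaves t = i + 1 \<and> young_leaves t = 0}"
          using leaf by (force simp: S_def forests_def simp del: young_leaves.simps leaves.simps)
      next
        fix t assume t: "t \<in> {t \<in> weakly_increasing_trees M. leaves t = i + 1 \<and> young_leaves t = 0}"
        obtain l ts where eq: "t = Node l ts" by (cases t)
        have "l = 0" using t eq by (simp add: weakly_increasing_trees_def)
        thus "t \<in> Node 0 ` ?S"
          using t eq by (auto simp: S_def forests_def simp del: young_leaves.simps leaves.simps)
      qed
    qed (auto intro: inj_onI)
    hence card: "card ?S = tree_gamma M i" by (simp add: tree_gamma_def bij_betw_same_card)
    have "forest_weight 0 r q ts = q ^ (i + 1) * r ^ (size M - 1 - 2 * i)" if "ts \<in> ?S" for ts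
    proof -
      have "nleaves ts = i + 1" "forest_labels ts = M" "nyoung ts = 0"
        using that leaf[of ts] by (auto simp: S_def forests_iff simp del: young_leaves.simps leaves.simps)
      thus ?thesis using forest_weight_no_young(1)[of ts r q] by (simp del: young_leaves.simps leaves.simps)
    qed
    hence "(\<Sum>ts\<in>?S. forest_weight 0 r q ts) = (\<Sum>ts\<in>?S. q ^ (i + 1) * r ^ (size M - 1 - 2 * i))"
      by (intro sum.cong) auto
    thus "(\<Sum>ts\<in>?S. forest_weight 0 r q ts) = of_nat (tree_gamma M i) * q ^ (i + 1) * r ^ (size M - 1 - 2 * i)"
      unfolding sum_constant card by (simp only: mult.assoc)
  qed simp
  finally show ?thesis by (simp add: r_def q_def K_def)
qed

section \<open>Inserting copies of the largest letter into a word\<close>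

lemma des_Nil [simp]: "des [] = 0" and des_single [simp]: "des [a] = 0"
  by (simp_all add: des_def)

lemma des_Cons [simp]: "des (a # b # w) = (if b < a then 1 else 0) + des (b # w)"
proof -
  let ?D = "\<lambda>w. {j. Suc j < length w \<and> w ! Suc j < w ! j}"
  have "?D (a # b # w) = (if b < a then {0} else {}) \<union> Suc ` ?D (b # w)"
  proof (rule set_eqI)
    fix x
    show "x \<in> ?D (a # b # w) \<longleftrightarrow> x \<in> (if b < a then {0} else {}) \<union> Suc ` ?D (b # w)"
      by (cases x) auto
  qed
  moreover have "finite (?D (b # w))" by simp
  ultimately show ?thesis by (simp add: des_def card_image)
qed

lemma des_Cons_le: "des (a # w) \<le> length w"
proof (induction w arbitrary: a)
  case (Cons b w)
  show ?case using Cons.IH[of b] by simp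
qed simp

lemma des_Cons_0: "des (0 # w) = des w"
  by (cases w) simp_all

definition word_fibre :: "nat \<Rightarrow> nat list \<Rightarrow> nat list set" where
  "word_fibre n w = {w'. set w' \<subseteq> {..n} \<and> filter (\<lambda>a. a < n) w' = w}"

abbreviation cntW :: "nat \<Rightarrow> nat list \<Rightarrow> nat" where
  "cntW n w \<equiv> count (mset w) n"

lemma mset_word_fibre:
  assumes "w' \<in> word_fibre n w"
  shows "mset w' = mset w + replicate_mset (cntW n w') n"
proof (rule multiset_eqI)
  fix x
  have f: "set w' \<subseteq> {..n}" "mset w = filter_mset (\<lambda>x. x < n) (mset w')"
    using assms by (auto simp: word_fibre_def)
  have "count (mset w') x = 0" if "x > n"
    using f(1) that by (auto simp: count_eq_zero_iff)
  thus "count (mset w') x = count (mset w + replicate_mset (cntW n w') n) x"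
    by (auto simp: f(2) linorder_neq_iff)
qed

lemma graded_word_fibre: "graded (cntW n) (word_fibre n w)"
  unfolding graded_def
proof (rule allI)
  fix p
  have "length w' = length w + p" if "w' \<in> word_fibre n w" "cntW n w' = p" for w'
    using mset_word_fibre[OF that(1)] that(2) by (metis size_mset size_replicate_mset size_union)
  hence "{w' \<in> word_fibre n w. cntW n w' = p} \<subseteq> {w'. set w' \<subseteq> {..n} \<and> length w' = length w + p}"
    by (auto simp: word_fibre_def)
  thus "finite {w' \<in> word_fibre n w. cntW n w' = p}"
    by (rule finite_subset) (rule finite_lists_length_eq, simp)
qed

text \<open>The letter \<open>c\<close> precedes the word; \<open>c = 0\<close> adds no descent.\<close>

definition word_gf :: "'r::comm_ring_1 \<Rightarrow> nat \<Rightarrow> nat \<Rightarrow> nat list \<Rightarrow> 'r fps" where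
  "word_gf x n c w = gf (cntW n) (\<lambda>w'. x ^ des (c # w')) (word_fibre n w)"

lemma gf_Cons_top: 
  assumes "c \<le> n"
  shows "gf (cntW n) (\<lambda>w'. x ^ des (c # w')) (Cons n ` word_fibre n w) = fps_X * word_gf x n n w"
  using gf_bij[of "Cons n" "word_fibre n w" "Cons n ` word_fibre n w" "cntW n" "cntW n" 1
      "\<lambda>w'. x ^ des (c # w')" "\<lambda>w'. x ^ des (n # w')"] assms
  by (simp add: word_gf_def inj_on_imp_bij_betw)

lemma word_gf_Nil:
  assumes "c \<le> n"
  shows "word_gf x n c [] = 1 + fps_X * word_gf x n n []"
proof -
  have "word_fibre n [] = {[]} \<union> Cons n ` word_fibre n []"
  proof (intro equalityI subsetI)
    fix w assume "w \<in> word_fibre n []"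
    thus "w \<in> {[]} \<union> Cons n ` word_fibre n []" by (cases w) (auto simp: word_fibre_def split: if_splits)
  qed (auto simp: word_fibre_def)
  hence "word_gf x n c [] = gf (cntW n) (\<lambda>w'. x ^ des (c # w')) ({[]} \<union> Cons n ` word_fibre n [])"
    by (simp add: word_gf_def)
  also have "\<dots> = gf (cntW n) (\<lambda>w'. x ^ des (c # w')) {[]} + fps_X * word_gf x n n []"
    unfolding gf_Cons_top[OF assms, symmetric]
    by (rule gf_union) (auto intro: graded_image[OF graded_word_fibre, where s = 1] graded_subset[OF graded_word_fibre[of n "[]"]] simp: word_fibre_def)
  finally show ?thesis by (simp add: gf_singleton)
qed

text \<open>The enlarged word begins with \<open>d\<close> or with an inserted \<open>n\<close>, and
  the latter makes no descent after \<open>c \<le> n\<close>.\<close>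

lemma word_gf_Cons:
  assumes "c \<le> n" "d < n"
  shows "word_gf x n c (d # w) = fps_const (if d < c then x else 1) * word_gf x n d w + fps_X * word_gf x n n (d # w)"
proof -
  have eq: "word_fibre n (d # w) = Cons d ` word_fibre n w \<union> Cons n ` word_fibre n (d # w)"
  proof (intro equalityI subsetI)
    fix w' assume "w' \<in> word_fibre n (d # w)"
    thus "w' \<in> Cons d ` word_fibre n w \<union> Cons n ` word_fibre n (d # w)"
      by (cases w') (auto simp: word_fibre_def image_iff split: if_splits)
  qed (use assms in \<open>auto simp: word_fibre_def\<close>)
  have "gf (cntW n) (\<lambda>w'. x ^ des (c # w')) (Cons d ` word_fibre n w) = 
      fps_X ^ 0 * gf (cntW n) (\<lambda>w'. (if d < c then x else 1) * x ^ des (d # w')) (word_fibre n w)"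
    by (rule gf_bij[where h = "Cons d"]) (use assms in \<open>auto simp: inj_on_imp_bij_betw\<close>)
  hence d: "gf (cntW n) (\<lambda>w'. x ^ des (c # w')) (Cons d ` word_fibre n w) =
      fps_const (if d < c then x else 1) * word_gf x n d w"
    by (simp add: gf_cmult word_gf_def)
  have "word_gf x n c (d # w) = gf (cntW n) (\<lambda>w'. x ^ des (c # w')) (Cons d ` word_fibre n w \<union> Cons n ` word_fibre n (d # w))"
    unfolding word_gf_def eq[symmetric] ..
  also have "\<dots> = gf (cntW n) (\<lambda>w'. x ^ des (c # w')) (Cons d ` word_fibre n w) + fps_X * word_gf x n n (d # w)"
    unfolding gf_Cons_top[OF assms(1), symmetric]
    using assms(2)
    by (intro gf_union graded_image[OF graded_word_fibre, where s = 1] graded_image[OF graded_word_fibre, where s = 0]) auto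
  finally show ?thesis unfolding d .
qed

text \<open>The runs of \<open>n\<close> in the gaps are independent. A gap that is a descent
  contributes \<open>x / (1 - z)\<close>, any other gap before a letter
  \<open>1 + x z / (1 - z)\<close>, and the end of the word \<open>1 / (1 - z)\<close>; the power of
  \<open>1 - fps_X\<close> clears all denominators.\<close>

lemma word_gf_eq:
  assumes "c < n" "set w \<subseteq> {..<n}"
  shows "(1 - fps_X) ^ Suc (length w) * word_gf x n c w =
    fps_const (x ^ des (c # w)) * (1 - fps_X + fps_const x * fps_X) ^ (length w - des (c # w))"
  using assms
proof (induction w arbitrary: c)
  case Nil
  have "(1 - fps_X) * word_gf x n n [] = 1"
    using word_gf_Nil[of n n x] by (simp add: algebra_simps)
  hence "(1 - fps_X) * word_gf x n c [] = (1 - fps_X) + fps_X"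
    using word_gf_Nil[of c n x] Nil by (simp add: algebra_simps)
  thus ?case by simp
next
  case (Cons d w)
  have d: "d < n" and w: "set w \<subseteq> {..<n}" using Cons.prems by auto
  \<comment> \<open>The numerator contributed by the gap between \<open>c\<close> and
    \<open>d\<close>.\<close>
  define Y where "Y = (if d < c then fps_const x else 1 - fps_X + fps_const x * fps_X)"
  have 1: "(1 - fps_X) * word_gf x n n (d # w) = fps_const x * word_gf x n d w"
    using word_gf_Cons[of n n d x w] d by (simp add: algebra_simps)
  have "(1 - fps_X) * word_gf x n c (d # w) = (1 - fps_X) * fps_const (if d < c then x else 1) * word_gf x n d w
      + fps_X * ((1 - fps_X) * word_gf x n n (d # w))"
    using word_gf_Cons[of c n d x w] Cons.prems by (simp add: algebra_simps)
  hence 2: "(1 - fps_X) * word_gf x n c (d # w) = Y * word_gf x n d w"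
    unfolding 1 Y_def by (cases "d < c") (simp_all add: algebra_simps)
  have "(1 - fps_X) ^ Suc (length (d # w)) * word_gf x n c (d # w) =
      (1 - fps_X) ^ Suc (length w) * ((1 - fps_X) * word_gf x n c (d # w))"
    by (simp add: algebra_simps)
  also have "\<dots> = Y * ((1 - fps_X) ^ Suc (length w) * word_gf x n d w)" unfolding 2 by (simp add: mult_ac)
  also have "\<dots> = Y * (fps_const (x ^ des (d # w)) * (1 - fps_X + fps_const x * fps_X) ^ (length w - des (d # w)))"
    using Cons.IH[OF d w] by simp
  also have "\<dots> = fps_const (x ^ des (c # d # w)) * (1 - fps_X + fps_const x * fps_X) ^ (length (d # w) - des (c # d # w))"
    using des_Cons_le[of d w] by (auto simp: Y_def Suc_diff_le mult_ac simp flip: fps_const_mult)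
  finally show ?case .
qed

lemma one_minus_X_mult_nth:
  "fps_nth ((1 - fps_X) * F) p = fps_nth F p - (if p = 0 then 0 else fps_nth F (p - 1))"
  for F :: "'r::comm_ring_1 fps"
  by (simp add: left_diff_distrib)

text \<open>By Pascal's rule, multiplication by \<open>1 - z\<close> lowers \<open>l\<close> by one;
  for \<open>l = 0\<close> it lowers \<open>j\<close> and leaves a factor \<open>z\<close>.\<close>

lemma binomial_column_fps:
  "(1 - fps_X) ^ Suc (l + j) * Abs_fps (\<lambda>p. of_nat ((l + p) choose (l + j))) = (fps_X ^ j :: 'r::comm_ring_1 fps)"
proof (induction l)
  case 0
  show ?case
  proof (induction j)
    case 0
    show ?case by (rule fps_ext) (simp add: one_minus_X_mult_nth)
  next
    case (Suc j)
    have *: "(1 - fps_X) * Abs_fps (\<lambda>p. of_nat (p choose Suc j)) =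
      fps_X * Abs_fps (\<lambda>p. of_nat (p choose j) :: 'r)"
    proof (rule fps_ext)
      fix p
      show "fps_nth ((1 - fps_X) * Abs_fps (\<lambda>p. of_nat (p choose Suc j))) p =
        fps_nth (fps_X * Abs_fps (\<lambda>p. of_nat (p choose j) :: 'r)) p"
        unfolding one_minus_X_mult_nth by (cases p) simp_all
    qed
    have "(1 - fps_X) ^ Suc (0 + Suc j) * Abs_fps (\<lambda>p. of_nat ((0 + p) choose (0 + Suc j))) =
      (1 - fps_X) ^ Suc j * ((1 - fps_X) * Abs_fps (\<lambda>p. of_nat (p choose Suc j) :: 'r))"
      by (simp add: mult_ac)
    also have "\<dots> = fps_X * ((1 - fps_X) ^ Suc j * Abs_fps (\<lambda>p. of_nat (p choose j)))"
      unfolding * by (simp only: mult_ac)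
    finally show ?case using Suc by simp
  qed
next
  case (Suc l)
  have *: "(1 - fps_X) * Abs_fps (\<lambda>p. of_nat ((Suc l + p) choose (Suc l + j))) =
      Abs_fps (\<lambda>p. of_nat ((l + p) choose (l + j)) :: 'r)"
  proof (rule fps_ext)
    fix p
    show "fps_nth ((1 - fps_X) * Abs_fps (\<lambda>p. of_nat ((Suc l + p) choose (Suc l + j)))) p =
      fps_nth (Abs_fps (\<lambda>p. of_nat ((l + p) choose (l + j)) :: 'r)) p"
      unfolding one_minus_X_mult_nth by (cases p; cases j) (simp_all add: binomial_eq_0)
  qed
  have "(1 - fps_X) ^ Suc (Suc l + j) * Abs_fps (\<lambda>p. of_nat ((Suc l + p) choose (Suc l + j))) =
      (1 - fps_X) ^ Suc (l + j) * ((1 - fps_X) * Abs_fps (\<lambda>p. of_nat ((Suc l + p) choose (Suc l + j)) :: 'r))"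
    by (simp only: power_Suc add_Suc mult_ac)
  thus ?case unfolding * Suc.IH .
qed

text \<open>The binomial theorem for \<open>(x z + (1 - z)) ^ (m - l)\<close>, followed by termwise
  division by \<open>(1 - z) ^ Suc m\<close> through \<open>binomial_column_fps\<close>. The index
  \<open>j\<close> is the number of descents created by the insertion.\<close>

lemma word_gf_nth:
  fixes x :: "'r::idom"
  assumes "0 < n" "set w \<subseteq> {..<n}"
  shows "fps_nth (word_gf x n 0 w) p =
    (\<Sum>j\<le>length w - des w. of_nat (((des w + p) choose (des w + j)) * ((length w - des w) choose j)) * x ^ (des w + j))"
proof -
  define l m where "l = des w" and "m = length w"
  have l: "l \<le> m" using des_Cons_le[of 0 w] by (simp add: l_def m_def des_Cons_0)
  define T where "T = (\<lambda>j. Abs_fps (\<lambda>p. of_nat ((l + p) choose (l + j))) :: 'r fps)"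
  define F where "F = (\<Sum>j\<le>m - l. fps_const (of_nat ((m - l) choose j) * x ^ (l + j)) * T j)"
  have "(1 - fps_X) ^ Suc m * F =
      (\<Sum>j\<le>m - l. fps_const (x ^ l) * (of_nat ((m - l) choose j) * (fps_const x * fps_X) ^ j * (1 - fps_X) ^ (m - l - j)))"
    unfolding F_def sum_distrib_left
  proof (rule sum.cong)
    fix j assume "j \<in> {..m - l}"
    hence "Suc m = Suc (l + j) + (m - l - j)" using l by simp
    hence "(1 - fps_X :: 'r fps) ^ Suc m = (1 - fps_X) ^ (m - l - j) * (1 - fps_X) ^ Suc (l + j)"
      by (metis power_add mult.commute)
    hence "(1 - fps_X) ^ Suc m * (fps_const (of_nat ((m - l) choose j) * x ^ (l + j)) * T j) =
      (1 - fps_X) ^ (m - l - j) * fps_const (of_nat ((m - l) choose j) * x ^ (l + j)) *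
      ((1 - fps_X) ^ Suc (l + j) * T j)"
      by (simp only: mult_ac)
    also have "(1 - fps_X) ^ Suc (l + j) * T j = fps_X ^ j"
      unfolding T_def by (rule binomial_column_fps)
    finally show "(1 - fps_X) ^ Suc m * (fps_const (of_nat ((m - l) choose j) * x ^ (l + j)) * T j) =
      fps_const (x ^ l) * (of_nat ((m - l) choose j) * (fps_const x * fps_X) ^ j * (1 - fps_X) ^ (m - l - j))"
      by (simp add: power_add power_mult_distrib mult_ac fps_of_nat flip: fps_const_mult fps_const_power)
  qed simp
  also have "\<dots> = fps_const (x ^ l) * (fps_const x * fps_X + (1 - fps_X)) ^ (m - l)"
    unfolding binomial_ring sum_distrib_left[symmetric] ..
  also have "\<dots> = (1 - fps_X) ^ Suc m * word_gf x n 0 w"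
    using word_gf_eq[OF assms, of x] by (simp add: des_Cons_0 l_def m_def add_ac)
  finally have "(1 - fps_X) ^ Suc m * F = (1 - fps_X) ^ Suc m * word_gf x n 0 w" .
  moreover have "(1 - fps_X :: 'r fps) \<noteq> 0"
  proof
    assume "(1 - fps_X :: 'r fps) = 0"
    hence "fps_nth (1 - fps_X :: 'r fps) 0 = 0" by simp
    thus False by simp
  qed
  ultimately have "word_gf x n 0 w = F" by simp
  thus ?thesis
    by (simp add: F_def T_def fps_sum_nth mult_ac flip: l_def m_def)
qed

definition eulerian_number :: "nat multiset \<Rightarrow> nat \<Rightarrow> nat" where
  "eulerian_number M t = card {w. mset w = M \<and> des w = t}"

lemma coeff_sum_des:
  assumes "finite S"
  shows "coeff (\<Sum>w\<in>S. monom 1 (des w) :: real poly) t = of_nat (card {w\<in>S. des w = t})"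
proof -
  have "{w\<in>S. des w = t} = S \<inter> {w. des w = t}" by auto
  with assms show ?thesis by (simp add: coeff_sum sum.If_cases)
qed

lemma finite_mset_eq: "finite {w. mset w = M}"
  using finite_permutations_of_multiset[of M] by (simp add: permutations_of_multiset_def)

lemma words_insert:
  assumes M: "\<forall>x\<in>#M. x < n"
  shows "{w. mset w = M + replicate_mset p n} = (\<Union>w\<in>{w. mset w = M}. {w'\<in>word_fibre n w. cntW n w' = p})"
proof (intro equalityI subsetI)
  fix w assume w: "w \<in> {w. mset w = M + replicate_mset p n}"
  have M0: "filter_mset (\<lambda>x. x < n) M = M" "count M n = 0"
    using M by (auto simp: filter_mset_eq_conv count_eq_zero_iff)
  have "set w \<subseteq> {..n}"
  proof
    fix x assume "x \<in> set w"
    hence "x \<in># M + replicate_mset p n" using w by (metis mem_Collect_eq set_mset_mset)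
    thus "x \<in> {..n}" using M by (auto split: if_splits)
  qed
  moreover have "mset (filter (\<lambda>a. a < n) w) = M" "cntW n w = p" using w M0 by (simp_all add: mset_filter)
  ultimately show "w \<in> (\<Union>w\<in>{w. mset w = M}. {w'\<in>word_fibre n w. cntW n w' = p})"
    by (auto simp: word_fibre_def)
next
  fix w' assume "w' \<in> (\<Union>w\<in>{w. mset w = M}. {w'\<in>word_fibre n w. cntW n w' = p})"
  thus "w' \<in> {w. mset w = M + replicate_mset p n}" using mset_word_fibre by force
qed

text \<open>A word with \<open>l\<close> descents gains \<open>t - l\<close> new ones: these are
  located in as many of its \<open>size M - l\<close> non-descent gaps, each receiving at least one
  \<open>n\<close>. The other copies are spread freely over \<open>t + 1\<close> gaps, in
  \<open>(l + p) choose t\<close> ways. The proof reads this off from \<open>word_gf_nth\<close>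
  with the polynomial variable for \<open>x\<close>.\<close>

lemma eulerian_number_insert:
  assumes n: "0 < n" and M: "\<forall>x\<in>#M. x < n"
  shows "eulerian_number (M + replicate_mset p n) t =
    (\<Sum>l\<le>t. eulerian_number M l * ((l + p) choose t) * ((size M - l) choose (t - l)))"
proof -
  let ?W = "\<lambda>M. {w. mset w = M}"
  have monom: "monom (of_nat a :: real) e = of_nat a * [:0, 1:] ^ e" for a e
    by (simp add: monom_altdef of_nat_poly)
  let ?f = "\<lambda>w. if des w \<le> t then ((des w + p) choose t) * ((size M - des w) choose (t - des w)) else 0"
  have "(\<Sum>w'\<in>?W (M + replicate_mset p n). monom 1 (des w') :: real poly) =
    (\<Sum>w\<in>?W M. \<Sum>w'\<in>{w'\<in>word_fibre n w. cntW n w' = p}. [:0, 1:] ^ des w')"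
    unfolding words_insert[OF M] monom_altdef
    by (subst sum.UNION_disjoint)
       (use graded_word_fibre[of n] in \<open>auto simp: finite_mset_eq graded_def word_fibre_def\<close>)
  also have "\<dots> = (\<Sum>w\<in>?W M. fps_nth (word_gf [:0, 1:] n 0 w) p)"
    by (simp add: word_gf_def gf_nth des_Cons_0)
  also have "\<dots> = (\<Sum>w\<in>?W M. \<Sum>j\<le>size M - des w.
      monom (of_nat (((des w + p) choose (des w + j)) * ((size M - des w) choose j))) (des w + j))"
  proof (rule sum.cong)
    fix w assume w: "w \<in> ?W M"
    hence "set w \<subseteq> {..<n}" using M by auto
    moreover have "length w = size M" using w by auto
    ultimately show "fps_nth (word_gf [:0, 1:] n 0 w) p = (\<Sum>j\<le>size M - des w.
      monom (of_nat (((des w + p) choose (des w + j)) * ((size M - des w) choose j)) :: real) (des w + j))"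
      using word_gf_nth[OF n, of w "[:0, 1:] :: real poly" p]
      unfolding monom by (simp only:)
  qed simp
  finally have "real (eulerian_number (M + replicate_mset p n) t) = coeff (\<Sum>w\<in>?W M. \<Sum>j\<le>size M - des w.
      monom (of_nat (((des w + p) choose (des w + j)) * ((size M - des w) choose j))) (des w + j)) t"
    using coeff_sum_des[OF finite_mset_eq, of "M + replicate_mset p n" t] by (simp add: eulerian_number_def)
  also have "\<dots> = (\<Sum>w\<in>?W M. real (?f w))"
    unfolding coeff_sum coeff_monom
  proof (rule sum.cong)
    fix w assume "w \<in> ?W M"
    show "(\<Sum>j\<le>size M - des w. if des w + j = t then real (((des w + p) choose (des w + j)) * ((size M - des w) choose j)) else 0) = real (?f w)"
    proof (cases "des w \<le> t")
      case True
      hence "(des w + j = t) = (j = t - des w)" for j by auto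
      thus ?thesis using True by (auto simp: sum.delta)
    qed auto
  qed simp
  finally have "eulerian_number (M + replicate_mset p n) t = (\<Sum>w\<in>?W M. ?f w)"
    by (simp only: of_nat_sum[symmetric] of_nat_eq_iff)
  also have "\<dots> = (\<Sum>w\<in>{w\<in>?W M. des w \<le> t}. ?f w)"
    by (rule sum.mono_neutral_right) (auto simp: finite_mset_eq)
  also have "\<dots> = (\<Sum>l\<le>t. \<Sum>w\<in>{w\<in>{w\<in>?W M. des w \<le> t}. des w = l}. ?f w)"
    by (rule sum.group[symmetric]) (auto simp: finite_mset_eq)
  also have "\<dots> = (\<Sum>l\<le>t. eulerian_number M l * ((l + p) choose t) * ((size M - l) choose (t - l)))"
  proof (rule sum.cong)
    fix l assume l: "l \<in> {..t}"
    have "{w\<in>{w\<in>?W M. des w \<le> t}. des w = l} = {w. mset w = M \<and> des w = l}" using l by auto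
    moreover have "(\<Sum>w\<in>{w. mset w = M \<and> des w = l}. ?f w) =
      (\<Sum>w\<in>{w. mset w = M \<and> des w = l}. ((l + p) choose t) * ((size M - l) choose (t - l)))"
      by (rule sum.cong) (use l in auto)
    ultimately show "(\<Sum>w\<in>{w\<in>{w\<in>?W M. des w \<le> t}. des w = l}. ?f w) =
      eulerian_number M l * ((l + p) choose t) * ((size M - l) choose (t - l))"
      by (simp add: eulerian_number_def)
  qed simp
  finally show ?thesis .
qed

lemma coeff_multiset_eulerian: "coeff (multiset_eulerian ms) t = of_nat (eulerian_number (vec_mset ms) t)"
  using coeff_sum_des[OF finite_mset_eq, of "vec_mset ms" t]
  by (simp add: multiset_eulerian_def permutations_of_multiset_def eulerian_number_def)

section \<open>Words with all multiplicities equal\<close>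

definition uniform_mset :: "nat \<Rightarrow> nat \<Rightarrow> nat multiset" where
  "uniform_mset k j = (\<Sum>i=1..j. replicate_mset k i)"

lemma uniform_mset_simps [simp]:
  "uniform_mset k 0 = {#}" "uniform_mset k (Suc j) = uniform_mset k j + replicate_mset k (Suc j)"
  by (simp_all add: uniform_mset_def)

lemma size_uniform_mset [simp]: "size (uniform_mset k j) = k * j"
  by (induction j) simp_all

lemma in_uniform_mset: "x \<in># uniform_mset k j \<Longrightarrow> x \<le> j"
  by (induction j) (auto split: if_splits)

text \<open>The numbers \<open>b_t\<close> of the opening comment, indexed so that there are
  \<open>Suc j\<close> distinct letters and \<open>k * j\<close> bounds the number of
  descents.\<close>

definition uniform_eulerian :: "nat \<Rightarrow> nat \<Rightarrow> nat \<Rightarrow> nat" where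
  "uniform_eulerian k j t = eulerian_number (uniform_mset k (Suc j)) t"

lemma uniform_eulerian_Suc:
  "uniform_eulerian k (Suc j) t = (\<Sum>l\<le>t. uniform_eulerian k j l * ((l + k) choose t) * ((k * Suc j - l) choose (t - l)))"
proof -
  have "\<forall>x\<in>#uniform_mset k (Suc j). x < Suc (Suc j)"
    using in_uniform_mset[of _ k "Suc j"] by (auto simp: less_Suc_eq_le)
  thus ?thesis
    using eulerian_number_insert[of "Suc (Suc j)" "uniform_mset k (Suc j)" k t]
    unfolding uniform_eulerian_def uniform_mset_simps(2)[of k "Suc j"] size_uniform_mset by simp
qed

lemma uniform_eulerian_zero: "uniform_eulerian k 0 t = (if t = 0 then 1 else 0)"
proof -
  have "{w. mset w = {#} \<and> des w = l} = (if l = 0 then {[]} else {})" for l by auto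
  hence e: "eulerian_number {#} l = (if l = 0 then 1 else 0)" for l by (simp add: eulerian_number_def)
  have "uniform_eulerian k 0 t = (\<Sum>l\<le>t. eulerian_number {#} l * ((l + k) choose t) * ((0 - l) choose (t - l)))"
    using eulerian_number_insert[of "Suc 0" "{#}" k t] by (simp add: uniform_eulerian_def)
  also have "\<dots> = (\<Sum>l\<in>{0}. eulerian_number {#} l * ((l + k) choose t) * ((0 - l) choose (t - l)))"
    by (rule sum.mono_neutral_right) (auto simp: e)
  finally show ?thesis by (simp add: e)
qed

lemma uniform_eulerian_bound: "t > k * j \<Longrightarrow> uniform_eulerian k j t = 0"
proof (induction j arbitrary: t)
  case (Suc j)
  have "uniform_eulerian k j l * ((l + k) choose t) = 0" for l
    using Suc by (cases "l > k * j") (auto simp: binomial_eq_0)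
  thus ?case by (simp only: uniform_eulerian_Suc) simp
qed (simp add: uniform_eulerian_zero)

lemma uniform_eulerian_0: "uniform_eulerian k j 0 = 1"
  by (induction j) (simp_all add: uniform_eulerian_zero uniform_eulerian_Suc)

text \<open>Complementing the second binomial coefficient and fixing the range of \<open>l\<close>
  gives the recursion a form that is visibly invariant under reversal.\<close>

lemma uniform_eulerian_rec:
  assumes "t \<le> k * Suc j"
  shows "uniform_eulerian k (Suc j) t = (\<Sum>l\<le>k * j. uniform_eulerian k j l * ((l + k) choose t) * ((k * Suc j - l) choose (k * Suc j - t)))"
proof -
  let ?f = "\<lambda>l. uniform_eulerian k j l * ((l + k) choose t) * ((k * Suc j - l) choose (k * Suc j - t))"
  have "uniform_eulerian k (Suc j) t = sum ?f {..t}"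
    unfolding uniform_eulerian_Suc
  proof (rule sum.cong)
    fix l assume "l \<in> {..t}"
    hence "(k * Suc j - l) choose (t - l) = (k * Suc j - l) choose (k * Suc j - t)"
      using assms by (subst binomial_symmetric) auto
    thus "uniform_eulerian k j l * ((l + k) choose t) * ((k * Suc j - l) choose (t - l)) = ?f l" by simp
  qed simp
  also have "\<dots> = sum ?f {..k * Suc j}"
    by (rule sum.mono_neutral_left) (use assms in \<open>auto intro!: binomial_eq_0\<close>)
  also have "\<dots> = sum ?f {..k * j}"
    by (rule sum.mono_neutral_right) (auto simp: uniform_eulerian_bound)
  finally show ?thesis .
qed

text \<open>The reflection \<open>l -> k * j - l\<close> interchanges the two upper entries
  \<open>l + k\<close> and \<open>k * Suc j - l\<close>, while \<open>t -> k * Suc j - t\<close>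
  interchanges the lower ones.\<close>

lemma uniform_eulerian_sym: "t \<le> k * j \<Longrightarrow> uniform_eulerian k j (k * j - t) = uniform_eulerian k j t"
proof (induction j arbitrary: t)
  case (Suc j)
  have "uniform_eulerian k (Suc j) (k * Suc j - t) = (\<Sum>l\<le>k * j. uniform_eulerian k j l * ((l + k) choose (k * Suc j - t)) * ((k * Suc j - l) choose t))"
    using Suc.prems by (subst uniform_eulerian_rec) auto
  also have "\<dots> = (\<Sum>l\<le>k * j. uniform_eulerian k j (k * j - l) * ((k * j - l + k) choose (k * Suc j - t)) * ((k * Suc j - (k * j - l)) choose t))"
    by (rule sum.reindex_bij_witness[of _ "\<lambda>l. k * j - l" "\<lambda>l. k * j - l"]) auto
  also have "\<dots> = (\<Sum>l\<le>k * j. uniform_eulerian k j l * ((l + k) choose t) * ((k * Suc j - l) choose (k * Suc j - t)))"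
  proof (rule sum.cong)
    fix l assume l: "l \<in> {..k * j}"
    hence "k * j - l + k = k * Suc j - l" "k * Suc j - (k * j - l) = l + k" by auto
    moreover have "uniform_eulerian k j (k * j - l) = uniform_eulerian k j l" using Suc.IH[of l] l by simp
    ultimately show "uniform_eulerian k j (k * j - l) * ((k * j - l + k) choose (k * Suc j - t)) * ((k * Suc j - (k * j - l)) choose t) =
      uniform_eulerian k j l * ((l + k) choose t) * ((k * Suc j - l) choose (k * Suc j - t))"
      by (simp only: mult_ac)
  qed simp
  also have "\<dots> = uniform_eulerian k (Suc j) t" using Suc.prems by (rule uniform_eulerian_rec[symmetric])
  finally show ?case .
qed simp

section \<open>The insertion operator on word polynomials\<close>

lemma binomial_step: "Suc i * (a choose Suc i) = (a choose i) * (a - i)"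
  using binomial_absorption[of i a] binomial_absorb_comp[of a i] by (simp add: mult.commute)

lemma pderiv_choose_power:
  fixes P :: "real poly"
  assumes "pderiv P = 1"
  shows "pderiv (of_nat (a choose i) * P ^ (a - i)) = of_nat (Suc i) * (of_nat (a choose Suc i) * P ^ (a - Suc i))"
proof -
  have "pderiv (of_nat (a choose i) * P ^ (a - i)) = of_nat ((a choose i) * (a - i)) * P ^ (a - Suc i)"
    using assms by (simp add: pderiv_mult pderiv_power pderiv_smult of_nat_poly)
  also have "\<dots> = of_nat (Suc i * (a choose Suc i)) * P ^ (a - Suc i)" unfolding binomial_step ..
  finally show ?thesis by (simp only: of_nat_mult mult.assoc)
qed

text \<open>Leibniz' rule with the factorials divided out:
  \<open>of_nat (a choose i) * P ^ (a - i)\<close> is the \<open>i\<close>-th derivative of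
  \<open>P ^ a\<close> over \<open>fact i\<close>.\<close>

lemma higher_pderiv_powers:
  fixes P Q :: "real poly"
  assumes "pderiv P = 1" "pderiv Q = 1"
  shows "(pderiv ^^ k) (P ^ a * Q ^ b) =
    fact k * (\<Sum>i\<le>k. (of_nat (a choose i) * P ^ (a - i)) * (of_nat (b choose (k - i)) * Q ^ (b - (k - i))))"
proof (induction k)
  case (Suc k)
  define U where "U i = of_nat (a choose i) * P ^ (a - i)" for i
  define V where "V i = of_nat (b choose i) * Q ^ (b - i)" for i
  have U: "pderiv (U i) = of_nat (Suc i) * U (Suc i)" and V: "pderiv (V i) = of_nat (Suc i) * V (Suc i)" for i
    unfolding U_def V_def by (rule pderiv_choose_power assms)+
  have "pderiv (\<Sum>i\<le>k. U i * V (k - i)) =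
    (\<Sum>i\<le>k. of_nat (Suc i) * (U (Suc i) * V (k - i))) + (\<Sum>i\<le>k. of_nat (Suc (k - i)) * (U i * V (Suc (k - i))))"
    by (simp add: higher_pderiv_sum[where n = 1, simplified] pderiv_mult U V sum.distrib mult_ac del: of_nat_Suc)
  also have "(\<Sum>i\<le>k. of_nat (Suc i) * (U (Suc i) * V (k - i))) = (\<Sum>i\<le>Suc k. of_nat i * (U i * V (Suc k - i)))"
    by (subst sum.atMost_Suc_shift) simp
  also have "(\<Sum>i\<le>k. of_nat (Suc (k - i)) * (U i * V (Suc (k - i)))) = (\<Sum>i\<le>Suc k. of_nat (Suc k - i) * (U i * V (Suc k - i)))"
    unfolding sum.atMost_Suc[of _ k] diff_self_eq_0 of_nat_0 mult_zero_left add_0_right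
    by (rule sum.cong) (simp_all only: Suc_diff_le atMost_iff)
  \<comment> \<open>With both sums on the same terms, the factors \<open>i\<close> and
    \<open>Suc k - i\<close> add up to the constant \<open>Suc k\<close>.\<close>
  also have "(\<Sum>i\<le>Suc k. of_nat i * (U i * V (Suc k - i))) + (\<Sum>i\<le>Suc k. of_nat (Suc k - i) * (U i * V (Suc k - i))) =
      (\<Sum>i\<le>Suc k. of_nat (Suc k) * (U i * V (Suc k - i)))"
    unfolding sum.distrib[symmetric] by (rule sum.cong) (auto simp: ring_distribs(2)[symmetric] simp flip: of_nat_add)
  finally have *: "pderiv (\<Sum>i\<le>k. U i * V (k - i)) = of_nat (Suc k) * (\<Sum>i\<le>Suc k. U i * V (Suc k - i))"
    by (simp only: sum_distrib_left)
  have pf: "pderiv (fact k * R) = fact k * pderiv R" for R :: "real poly"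
    by (metis add.right_neutral mult_zero_right of_nat_fact pderiv_mult pderiv_of_nat)
  have "(pderiv ^^ Suc k) (P ^ a * Q ^ b) = fact k * pderiv (\<Sum>i\<le>k. U i * V (k - i))"
    using Suc.IH unfolding U_def[symmetric] V_def[symmetric] by (simp only: funpow.simps o_apply pf)
  also have "\<dots> = fact (Suc k) * (\<Sum>i\<le>Suc k. U i * V (Suc k - i))"
    unfolding * fact_Suc by (simp only: mult_ac)
  finally show ?case unfolding U_def V_def .
qed simp

text \<open>The descent polynomial at \<open>x = s / (1 + s)\<close>, multiplied by
  \<open>(1 + s) ^ (k * j)\<close> to clear denominators.\<close>

definition word_poly :: "nat \<Rightarrow> nat \<Rightarrow> real poly" where
  "word_poly k j = (\<Sum>l\<le>k * j. of_nat (uniform_eulerian k j l) * [:0, 1:] ^ l * [:1, 1:] ^ (k * j - l))"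

lemma phi_factor: "phi = [:0, 1:] * [:1, 1:]"
  by simp

lemma smult_of_nat: "smult (of_nat a) p = of_nat a * p"
  by (simp add: of_nat_poly)

text \<open>Multiplication by \<open>phi ^ k\<close> raises both exponents of a term by
  \<open>k\<close>. Leibniz' rule then produces precisely the binomial coefficients of
  \<open>uniform_eulerian_rec\<close>.\<close>

lemma higher_pderiv_word_poly:
  "(pderiv ^^ k) (phi ^ k * word_poly k j) = fact k * word_poly k (Suc j)"
proof -
  let ?X = "[:0, 1:] :: real poly" and ?Y = "[:1, 1:] :: real poly"
  let ?m = "k * Suc j"
  have summand: "(pderiv ^^ k) (?X ^ (l + k) * ?Y ^ (?m - l)) =
      fact k * (\<Sum>t\<le>?m. of_nat (((l + k) choose t) * ((?m - l) choose (?m - t))) * ?X ^ t * ?Y ^ (?m - t))"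
    if l: "l \<le> k * j" for l
  proof -
    let ?g = "\<lambda>t. of_nat (((l + k) choose t) * ((?m - l) choose (?m - t))) * ?X ^ t * ?Y ^ (?m - t)"
    have lm: "l + k \<le> ?m" using l by simp
    have "(\<Sum>i\<le>k. (of_nat ((l + k) choose i) * ?X ^ (l + k - i)) * (of_nat ((?m - l) choose (k - i)) * ?Y ^ (?m - l - (k - i)))) =
      (\<Sum>t\<in>{l..l + k}. ?g t)"
    \<comment> \<open>The new index \<open>t = l + k - i\<close> is the exponent of \<open>s\<close>
      that remains after \<open>i\<close> derivatives fall on its power.\<close>
    proof (rule sum.reindex_bij_witness[of _ "\<lambda>t. l + k - t" "\<lambda>i. l + k - i"])
      fix i assume i: "i \<in> {..k}"
      have 1: "(l + k) choose i = (l + k) choose (l + k - i)"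
        using i by (intro binomial_symmetric) auto
      have 2: "(?m - l) choose (k - i) = (?m - l) choose (?m - l - (k - i))"
        using i lm by (intro binomial_symmetric) auto
      have 3: "?m - l - (k - i) = ?m - (l + k - i)" using i lm by auto
      show "?g (l + k - i) = (of_nat ((l + k) choose i) * ?X ^ (l + k - i)) * (of_nat ((?m - l) choose (k - i)) * ?Y ^ (?m - l - (k - i)))"
        unfolding 2 unfolding 1 3 by (simp only: of_nat_mult mult_ac)
    qed auto
    \<comment> \<open>Outside \<open>{l..l + k}\<close> one of the two binomial coefficients is 0. A
      range independent of \<open>l\<close> is what the later exchange of sums requires.\<close>
    also have "\<dots> = (\<Sum>t\<le>?m. ?g t)"
    proof (rule sum.mono_neutral_left)
      show "\<forall>t\<in>{..?m} - {l..l + k}. ?g t = 0"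
      proof
        fix t assume t: "t \<in> {..?m} - {l..l + k}"
        show "?g t = 0"
        proof (cases "t < l")
          case True
          hence "(?m - l) choose (?m - t) = 0" using lm by (intro binomial_eq_0) auto
          thus ?thesis by (simp only: mult_zero_right mult_zero_left of_nat_0)
        next
          case False
          hence "(l + k) choose t = 0" using t by (intro binomial_eq_0) auto
          thus ?thesis by (simp only: mult_zero_right mult_zero_left of_nat_0)
        qed
      qed
    qed (use lm in auto)
    finally show ?thesis
      by (subst higher_pderiv_powers) (simp_all only: pderiv_pCons, simp_all add: one_pCons)
  qed
  have "phi ^ k * word_poly k j = (\<Sum>l\<le>k * j. smult (of_nat (uniform_eulerian k j l)) (?X ^ (l + k) * ?Y ^ (?m - l)))"
    unfolding word_poly_def sum_distrib_left
  proof (rule sum.cong)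
    fix l assume "l \<in> {..k * j}"
    hence "?m - l = k + (k * j - l)" by auto
    thus "phi ^ k * (of_nat (uniform_eulerian k j l) * ?X ^ l * ?Y ^ (k * j - l)) = smult (of_nat (uniform_eulerian k j l)) (?X ^ (l + k) * ?Y ^ (?m - l))"
      unfolding phi_factor power_mult_distrib by (simp only: power_add smult_of_nat mult_ac)
  qed simp
  hence "(pderiv ^^ k) (phi ^ k * word_poly k j) =
      (\<Sum>l\<le>k * j. smult (of_nat (uniform_eulerian k j l)) ((pderiv ^^ k) (?X ^ (l + k) * ?Y ^ (?m - l))))"
    by (simp only: higher_pderiv_sum higher_pderiv_smult)
  also have "\<dots> = (\<Sum>l\<le>k * j. \<Sum>t\<le>?m. fact k * (of_nat (uniform_eulerian k j l * ((l + k) choose t) * ((?m - l) choose (?m - t))) * ?X ^ t * ?Y ^ (?m - t)))"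
  proof (rule sum.cong)
    fix l assume "l \<in> {..k * j}"
    hence "(pderiv ^^ k) (?X ^ (l + k) * ?Y ^ (?m - l)) =
      fact k * (\<Sum>t\<le>?m. of_nat (((l + k) choose t) * ((?m - l) choose (?m - t))) * ?X ^ t * ?Y ^ (?m - t))"
      by (intro summand) simp
    thus "smult (of_nat (uniform_eulerian k j l)) ((pderiv ^^ k) (?X ^ (l + k) * ?Y ^ (?m - l))) =
      (\<Sum>t\<le>?m. fact k * (of_nat (uniform_eulerian k j l * ((l + k) choose t) * ((?m - l) choose (?m - t))) * ?X ^ t * ?Y ^ (?m - t)))"
      by (simp only: smult_of_nat sum_distrib_left of_nat_mult mult_ac)
  qed simp
  also have "\<dots> = (\<Sum>t\<le>?m. fact k * (of_nat (\<Sum>l\<le>k * j. uniform_eulerian k j l * ((l + k) choose t) * ((?m - l) choose (?m - t))) * ?X ^ t * ?Y ^ (?m - t)))"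
    by (subst sum.swap) (simp only: of_nat_sum sum_distrib_left sum_distrib_right)
  also have "\<dots> = (\<Sum>t\<le>?m. fact k * (of_nat (uniform_eulerian k (Suc j) t) * ?X ^ t * ?Y ^ (?m - t)))"
    by (rule sum.cong) (simp_all only: uniform_eulerian_rec atMost_iff)
  finally show ?thesis unfolding word_poly_def by (simp only: sum_distrib_left)
qed

section \<open>The symmetric decomposition\<close>

text \<open>For one inserted letter, \<open>(l + 1) choose t\<close> leaves only
  \<open>l = t\<close> and \<open>l = t - 1\<close>.\<close>

lemma eulerian_number_last_letter:
  fixes k j :: nat
  shows "real (eulerian_number (add_mset (Suc (Suc j)) (uniform_mset k (Suc j))) t) =
    (real t + 1) * real (uniform_eulerian k j t) +
    (if t = 0 then 0 else (real (k * Suc j) + 1 - real t) * real (uniform_eulerian k j (t - 1)))"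
proof -
  let ?m = "k * Suc j"
  let ?f = "\<lambda>l. uniform_eulerian k j l * ((l + 1) choose t) * ((?m - l) choose (t - l))"
  have "\<forall>x\<in>#uniform_mset k (Suc j). x < Suc (Suc j)"
    using in_uniform_mset[of _ k "Suc j"] by (auto simp: less_Suc_eq_le)
  hence "eulerian_number (uniform_mset k (Suc j) + replicate_mset 1 (Suc (Suc j))) t = sum ?f {..t}"
    unfolding uniform_eulerian_def using eulerian_number_insert[of "Suc (Suc j)" "uniform_mset k (Suc j)" 1 t]
    by (simp only: size_uniform_mset zero_less_Suc)
  also have "sum ?f {..t} = sum ?f {t - 1..t}"
    by (rule sum.mono_neutral_right) (auto simp: binomial_eq_0)
  finally have e: "eulerian_number (add_mset (Suc (Suc j)) (uniform_mset k (Suc j))) t = sum ?f {t - 1..t}"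
    by simp
  show ?thesis
  proof (cases t)
    case 0
    thus ?thesis unfolding e by simp
  next
    case (Suc s)
    have "{t - 1..t} = {s, t}" using Suc by auto
    hence "sum ?f {t - 1..t} = uniform_eulerian k j s * (?m - s) + uniform_eulerian k j t * (t + 1)"
      using Suc by simp
    moreover have "real (uniform_eulerian k j s * (?m - s)) = (real ?m + 1 - real t) * real (uniform_eulerian k j s)"
    proof (cases "s \<le> k * j")
      case True
      hence "s \<le> ?m" by simp
      thus ?thesis using Suc by (simp add: of_nat_diff)
    qed (simp add: uniform_eulerian_bound)
    ultimately show ?thesis unfolding e using Suc by (simp add: algebra_simps)
  qed
qed

lemma vec_mset_eq: "vec_mset (replicate j k @ [1]) = add_mset (Suc j) (uniform_mset k j)"
proof -
  have "(\<Sum>i=1..Suc j. replicate_mset ((replicate j k @ [1]) ! (i - 1)) i) =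
    (\<Sum>i=1..j. replicate_mset ((replicate j k @ [1]) ! (i - 1)) i) + {#Suc j#}"
    by (simp add: nth_append)
  also have "(\<Sum>i=1..j. replicate_mset ((replicate j k @ [1]) ! (i - 1)) i) = uniform_mset k j"
    unfolding uniform_mset_def by (rule sum.cong) (auto simp: nth_append)
  finally show ?thesis by (simp add: vec_mset_def)
qed

text \<open>Comes from splitting \<open>k * Suc j + 1 - t\<close> in
  \<open>eulerian_number_last_letter\<close> as \<open>(k * j + 2 - t) + (k - 1)\<close>; the second
  summand goes into \<open>b_part\<close>. Both contributions of one \<open>b_l\<close> are kept
  together for the comparison with \<open>phi D phi\<close>.\<close>

definition a_part :: "nat \<Rightarrow> nat \<Rightarrow> real poly" where
  "a_part k j = (\<Sum>l\<le>k * j. monom (real (Suc l) * uniform_eulerian k j l) l + monom (real (k * j + 1 - l) * uniform_eulerian k j l) (Suc l))"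

definition b_part :: "nat \<Rightarrow> nat \<Rightarrow> real poly" where
  "b_part k j = (\<Sum>l\<le>k * j. monom ((real k - 1) * uniform_eulerian k j l) l)"

lemma coeff_b_part: "coeff (b_part k j) t = (real k - 1) * uniform_eulerian k j t"
  by (simp add: b_part_def coeff_sum uniform_eulerian_bound)

lemma coeff_a_part:
  "coeff (a_part k j) t = (real t + 1) * real (uniform_eulerian k j t) +
    (if t = 0 then 0 else (real (k * j) + 2 - real t) * real (uniform_eulerian k j (t - 1)))"
proof (cases t)
  case 0
  thus ?thesis by (simp add: a_part_def coeff_sum sum.distrib)
next
  case (Suc s)
  have "real (k * j + 1 - s) * real (uniform_eulerian k j s) = (real (k * j) + 2 - real t) * real (uniform_eulerian k j s)"
    using Suc by (cases "s \<le> k * j") (auto simp: of_nat_diff uniform_eulerian_bound)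
  thus ?thesis using Suc by (auto simp: a_part_def coeff_sum sum.distrib uniform_eulerian_bound algebra_simps)
qed

lemma degree_multiset_eulerian:
  assumes "1 \<le> k"
  shows "degree (multiset_eulerian (replicate (Suc j) k @ [1])) = k * j + 1"
proof -
  define A where "A = multiset_eulerian (replicate (Suc j) k @ [1])"
  have c: "coeff A t = (real t + 1) * real (uniform_eulerian k j t) +
    (if t = 0 then 0 else (real (k * Suc j) + 1 - real t) * real (uniform_eulerian k j (t - 1)))" for t
    unfolding A_def coeff_multiset_eulerian vec_mset_eq eulerian_number_last_letter ..
  have "degree A \<le> k * j + 1"
    by (rule degree_le) (auto simp: c uniform_eulerian_bound)
  \<comment> \<open>By symmetry the leading number is the constant one, counting the single sorted
    word.\<close>
  have "uniform_eulerian k j (k * j) = 1" using uniform_eulerian_sym[of 0 k j] uniform_eulerian_0 by simp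
  hence "coeff A (k * j + 1) = real k" by (simp add: c uniform_eulerian_bound algebra_simps)
  hence "k * j + 1 \<le> degree A" using assms by (intro le_degree) simp
  with \<open>degree A \<le> k * j + 1\<close> show ?thesis unfolding A_def[symmetric] by simp
qed

text \<open>The symmetry of \<open>b_part\<close> is that of the numbers \<open>b_l\<close>. For
  \<open>a_part\<close>, the reflection \<open>s -> k * j + 1 - s\<close> swaps \<open>b_s\<close>
  with \<open>b_(s-1)\<close> and the factor \<open>s + 1\<close> with \<open>k * j + 2 - s\<close>,
  hence the two summands of a coefficient.\<close>

lemma I_decomposition_multiset_eulerian:
  "I_decomposition (k * j + 1) (multiset_eulerian (replicate (Suc j) k @ [1])) (a_part k j) (b_part k j)"
  unfolding I_decomposition_def symmetric_poly_def
proof (intro conjI allI impI)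
  show "multiset_eulerian (replicate (Suc j) k @ [1]) = a_part k j + [:0, 1:] * b_part k j"
  proof (rule poly_eqI)
    fix t
    show "coeff (multiset_eulerian (replicate (Suc j) k @ [1])) t = coeff (a_part k j + [:0, 1:] * b_part k j) t"
      unfolding coeff_add coeff_X_mult coeff_multiset_eulerian vec_mset_eq eulerian_number_last_letter
        coeff_a_part coeff_b_part
      by (cases t) (simp_all add: algebra_simps)
  qed
  show "degree (a_part k j) \<le> k * j + 1"
    by (rule degree_le) (auto simp: coeff_a_part uniform_eulerian_bound)
  have db: "degree (b_part k j) \<le> k * j"
    by (rule degree_le) (auto simp: coeff_b_part uniform_eulerian_bound)
  thus "b_part k j = 0 \<or> degree (b_part k j) < k * j + 1" by simp
  show "degree (b_part k j) \<le> k * j + 1 - 1" using db by simp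
  show "coeff (b_part k j) s = coeff (b_part k j) (k * j + 1 - 1 - s)" if "s \<le> k * j + 1 - 1" for s
    using that uniform_eulerian_sym[of s k j] by (simp add: coeff_b_part)
  show "coeff (a_part k j) s = coeff (a_part k j) (k * j + 1 - s)" if "s \<le> k * j + 1" for s
  proof -
    consider "s = 0" | "s = k * j + 1" | "1 \<le> s" "s \<le> k * j" using \<open>s \<le> k * j + 1\<close> by linarith
    thus ?thesis
    proof cases
      case 3
      have 1: "uniform_eulerian k j (k * j + 1 - s) = uniform_eulerian k j (s - 1)"
        using uniform_eulerian_sym[of "s - 1" k j] 3 by (simp add: Suc_diff_le)
      have 2: "uniform_eulerian k j (k * j + 1 - s - 1) = uniform_eulerian k j s"
        using uniform_eulerian_sym[of s k j] 3 by simp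
      show ?thesis using 3 unfolding coeff_a_part 1 2 by (simp add: of_nat_diff algebra_simps)
    qed (use uniform_eulerian_sym[of 0 k j] in \<open>auto simp: coeff_a_part uniform_eulerian_bound uniform_eulerian_0\<close>)
  qed
qed

section \<open>Comparing trees with words\<close>

text \<open>Both sides start at 1 and change by the same operator when \<open>k\<close> copies of a
  new largest label or letter are inserted. The shift \<open>c\<close> is lost under the
  derivative.\<close>

lemma pderiv_shifted_forest_poly_uniform: "pderiv (shifted_forest_poly c (uniform_mset k j)) = word_poly k j"
proof (induction j)
  case 0
  show ?case by (simp add: shifted_forest_poly_empty word_poly_def uniform_eulerian_zero pderiv_pCons one_pCons)
next
  case (Suc j)
  have "fact k * pderiv (shifted_forest_poly c (uniform_mset k (Suc j))) = (pderiv ^^ k) (phi ^ k * word_poly k j)"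
    unfolding uniform_mset_simps Suc.IH[symmetric]
    by (rule shifted_forest_poly_insert(1)) (auto simp: less_Suc_eq_le dest: in_uniform_mset)
  also have "\<dots> = fact k * word_poly k (Suc j)" by (rule higher_pderiv_word_poly)
  finally show ?case by simp
qed

lemma shifted_forest_poly_two_more:
  "shifted_forest_poly c (add_mset (Suc (Suc j)) (add_mset (Suc j) (uniform_mset k j))) = phi * pderiv (phi * word_poly k j)"
proof -
  have le: "x \<le> j" if "x \<in># uniform_mset k j" for x using that by (rule in_uniform_mset)
  have "shifted_forest_poly c (add_mset (Suc j) (uniform_mset k j)) = phi * word_poly k j"
    unfolding pderiv_shifted_forest_poly_uniform[of c k j, symmetric]
    by (rule shifted_forest_poly_insert(2)) (auto simp: less_Suc_eq_le dest: le)
  moreover have "shifted_forest_poly c (add_mset (Suc (Suc j)) (add_mset (Suc j) (uniform_mset k j))) =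
      phi * pderiv (shifted_forest_poly c (add_mset (Suc j) (uniform_mset k j)))"
    by (rule shifted_forest_poly_insert(2)) (auto simp: less_Suc_eq_le dest: le)
  ultimately show ?thesis by simp
qed

text \<open>The product rule for \<open>s ^ Suc l * (1 + s) ^ Suc (N - l)\<close>, with
  \<open>N = k * j\<close>, yields the factors \<open>l + 1\<close> and \<open>N + 1 - l\<close> of
  \<open>a_part\<close>. Substituting \<open>c = x (1 + c)\<close> then collects the same power of
  \<open>1 + c\<close> from every term.\<close>

lemma poly_phi_word_poly:
  fixes x :: real
  assumes "0 < x" "x < 1" and c: "c = x / (1 - x)"
  shows "poly (phi * pderiv (phi * word_poly k j)) c = (1 + c) ^ (k * j + 3) * (x * poly (a_part k j) x)"
proof -
  let ?X = "[:0, 1:] :: real poly" and ?Y = "[:1, 1:] :: real poly"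
  let ?N = "k * j"
  have c1: "c = x * (1 + c)" using assms by (simp add: field_simps)
  have S: "phi * word_poly k j = (\<Sum>l\<le>?N. smult (uniform_eulerian k j l) (?X ^ Suc l * ?Y ^ Suc (?N - l)))"
    unfolding word_poly_def sum_distrib_left phi_factor
    by (rule sum.cong) (simp_all only: smult_of_nat power_Suc mult_ac)
  have pd: "pderiv (phi * word_poly k j) = (\<Sum>l\<le>?N. smult (uniform_eulerian k j l)
      (smult (real (Suc l)) (?X ^ l * ?Y ^ Suc (?N - l)) + smult (real (Suc (?N - l))) (?X ^ Suc l * ?Y ^ (?N - l))))"
  proof -
    have "pderiv (?X ^ Suc a * ?Y ^ Suc b) =
      smult (real (Suc a)) (?X ^ a * ?Y ^ Suc b) + smult (real (Suc b)) (?X ^ Suc a * ?Y ^ b)" for a b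
    proof -
      have "pderiv ?X = 1" "pderiv ?Y = 1" by (simp_all add: pderiv_pCons one_pCons)
      thus ?thesis unfolding pderiv_mult pderiv_power_Suc
        by (simp only: mult_1_left mult_1_right mult_smult_right mult_ac add_ac)
    qed
    thus ?thesis unfolding S
      by (simp only: higher_pderiv_sum[where n = 1, simplified] pderiv_smult)
  qed
  have XY: "poly ?X c = c" "poly ?Y c = 1 + c" by simp_all
  have "poly (phi * pderiv (phi * word_poly k j)) c = (c * (1 + c)) *
      (\<Sum>l\<le>?N. uniform_eulerian k j l * (real (Suc l) * (c ^ l * (1 + c) ^ Suc (?N - l)) + real (Suc (?N - l)) * (c ^ Suc l * (1 + c) ^ (?N - l))))"
    unfolding pd unfolding phi_factor
    by (simp only: poly_mult poly_sum poly_smult poly_add poly_power XY)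
  also have "\<dots> = (\<Sum>l\<le>?N. (1 + c) ^ (?N + 3) * (x * (real (Suc l) * uniform_eulerian k j l * x ^ l + real (?N + 1 - l) * uniform_eulerian k j l * x ^ Suc l)))"
    unfolding sum_distrib_left
  proof (rule sum.cong)
    fix l assume "l \<in> {..?N}"
    then obtain e where e: "?N = l + e" by (metis atMost_iff le_iff_add)
    have "c ^ l = x ^ l * (1 + c) ^ l" for l using c1 by (metis power_mult_distrib)
    hence p: "c ^ l = x ^ l * (1 + c) ^ l" "c ^ Suc l = x ^ Suc l * (1 + c) ^ Suc l" by blast+
    have cw: "c * (1 + c) = x * (1 + c) ^ 2" using c1 by (metis mult.assoc power2_eq_square)
    \<comment> \<open>Naming \<open>1 + c\<close> keeps its powers from being expanded by
      \<open>algebra_simps\<close>.\<close>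
    define w where "w = 1 + c"
    have d: "l + e - l = e" "l + e + 1 - l = Suc e" by simp_all
    show "c * (1 + c) * (uniform_eulerian k j l * (real (Suc l) * (c ^ l * (1 + c) ^ Suc (?N - l)) + real (Suc (?N - l)) * (c ^ Suc l * (1 + c) ^ (?N - l)))) =
      (1 + c) ^ (?N + 3) * (x * (real (Suc l) * uniform_eulerian k j l * x ^ l + real (?N + 1 - l) * uniform_eulerian k j l * x ^ Suc l))"
      unfolding cw p e d unfolding w_def[symmetric]
      by (simp add: power_add algebra_simps power2_eq_square power3_eq_cube del: of_nat_Suc)
  qed simp
  also have "\<dots> = (1 + c) ^ (?N + 3) * (x * poly (a_part k j) x)"
    by (simp only: a_part_def poly_sum poly_add poly_monom sum_distrib_left)
  finally show ?thesis .
qed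

text \<open>For each \<open>x\<close> in the unit interval, the tree polynomial is evaluated at
  \<open>s = c\<close> in two ways: through words by \<open>poly_phi_word_poly\<close>, and as a sum
  over trees without young leaves. Cancelling the common factor gives equality at infinitely many
  points.\<close>

lemma a_part_gamma:
  fixes k j :: nat
  defines "d \<equiv> k * j + 1"
  defines "M \<equiv> add_mset (Suc (Suc j)) (add_mset (Suc j) (uniform_mset k j))"
  shows "a_part k j = (\<Sum>i=0..d div 2. of_nat (tree_gamma M i) * monom 1 i * [:1, 1:] ^ (d - 2 * i))"
    (is "_ = ?g")
proof -
  have "poly (a_part k j - ?g) x = 0" if x: "0 < x" "x < 1" for x :: real
  proof -
    \<comment> \<open>The same number serves as shift parameter and as evaluation point, which is
      possible because the word side is the same for every shift.\<close>
    define c where "c = x / (1 - x)"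
    have "1 + c = 1 / (1 - x)" using x by (simp add: c_def field_simps)
    hence c0: "1 + c \<noteq> 0" and cx: "c = x * (1 + c)" using x by (simp_all add: c_def)
    \<comment> \<open>These identities turn the weights \<open>q\<close> and \<open>r\<close> into
      \<open>x\<close> and \<open>1 + x\<close> up to powers of \<open>1 + c\<close>, whose
      exponents add up to \<open>2 (i + 1) + (d - 2 i) = k * j + 3\<close> for every
      \<open>i\<close>.\<close>
    have c1: "c + c ^ 2 = (1 + c) ^ 2 * x" "1 + 2 * c = (1 + c) * (1 + x)"
      using cx by algebra+
    have size: "size M - 1 = d" "M \<noteq> {#}" by (simp_all add: M_def d_def)
    have "(1 + c) ^ (k * j + 3) * (x * poly (a_part k j) x) = poly (shifted_forest_poly c M) c"
      unfolding M_def shifted_forest_poly_two_more using poly_phi_word_poly[OF x c_def] by simp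
    also have "\<dots> = (\<Sum>i=0..d div 2. of_nat (tree_gamma M i) * (c + c ^ 2) ^ (i + 1) * (1 + 2 * c) ^ (d - 2 * i))"
      using poly_shifted_forest_poly_diag[OF size(2), of c] unfolding size(1) .
    also have "\<dots> = (\<Sum>i=0..d div 2. (1 + c) ^ (k * j + 3) * (x * (of_nat (tree_gamma M i) * x ^ i * (1 + x) ^ (d - 2 * i))))"
    proof (rule sum.cong)
      fix i assume "i \<in> {0..d div 2}"
      hence "k * j + 3 = 2 * (i + 1) + (d - 2 * i)" by (auto simp: d_def)
      hence "(1 + c) ^ (k * j + 3) = ((1 + c) ^ 2) ^ (i + 1) * (1 + c) ^ (d - 2 * i)"
        by (simp only: power_add power_mult)
      thus "of_nat (tree_gamma M i) * (c + c ^ 2) ^ (i + 1) * (1 + 2 * c) ^ (d - 2 * i) =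
        (1 + c) ^ (k * j + 3) * (x * (of_nat (tree_gamma M i) * x ^ i * (1 + x) ^ (d - 2 * i)))"
        unfolding c1 power_mult_distrib by (simp add: mult_ac)
    qed simp
    also have "\<dots> = (1 + c) ^ (k * j + 3) * (x * poly ?g x)"
      by (simp only: poly_sum poly_mult poly_of_nat poly_monom poly_power sum_distrib_left)
         (simp add: mult_ac)
    finally show ?thesis using c0 x by simp
  qed
  hence "{0<..<1} \<subseteq> {x. poly (a_part k j - ?g) x = 0}" by auto
  hence "infinite {x. poly (a_part k j - ?g) x = 0}"
    by (rule infinite_super) (simp add: infinite_Ioo)
  hence "a_part k j - ?g = 0" using poly_roots_finite by blast
  thus ?thesis by simp
qed

theorem theorem27:
  fixes k n d :: nat and A :: "real poly" and M :: "nat multiset"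
  assumes "k \<ge> 2" and "n \<ge> 2"
    and "A = multiset_eulerian (replicate (n - 1) k @ [1])"
    and "d = k * (n - 2) + 1"
    and "M = (\<Sum>j=1..n-2. replicate_mset k j) + {#n - 1, n#}"
  shows "degree A = d \<and>
    (\<forall>a b. I_decomposition d A a b \<longrightarrow>
      a = (\<Sum>i=0..d div 2. of_nat (tree_gamma M i) * monom 1 i * [:1, 1:] ^ (d - 2 * i)))"
proof -
  \<comment> \<open>With \<open>j = n - 2\<close>, the words have \<open>Suc j\<close> letters of
    multiplicity \<open>k\<close>, while the trees have only \<open>j\<close> such labels and two
    single ones; \<open>word_poly k j\<close> already refers to \<open>Suc j\<close>
    letters.\<close>
  obtain j where n: "n = Suc (Suc j)" using assms(2) by (metis add_2_eq_Suc le_Suc_ex)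
  have A: "A = multiset_eulerian (replicate (Suc j) k @ [1])" and d: "d = k * j + 1"
    using assms n by simp_all
  have M: "M = add_mset (Suc (Suc j)) (add_mset (Suc j) (uniform_mset k j))"
    using assms(5) by (simp add: n uniform_mset_def)
  have "degree A = d" unfolding A d by (rule degree_multiset_eulerian) (use assms(1) in simp)
  moreover have "I_decomposition d A (a_part k j) (b_part k j)"
    unfolding A d by (rule I_decomposition_multiset_eulerian)
  ultimately show ?thesis
    using I_decomposition_unique a_part_gamma[of k j] unfolding M d by blast
qed

end
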